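(* Let $G$ be a finite graph that contains no triangle ($K_3$) as an induced subgraph and contains no induced subgraph that is a subdivision of $K_4$. Then $\chi(G)\leq 4$.
   Context: A subdivision of a graph is obtained by replacing its edges by paths of arbitrary length (at least one), with pairwise internally disjoint paths. $\chi(G)$ denotes the chromatic number of $G$. *)

theory Defs
  imports "Graph_Theory.Graph_Theory"
begin

text \<open>
  A finite simple graph is a \<^locale>\<open>pair_graph\<close>: a finite set of vertices together with a
  symmetric, irreflexive set of pairs, each undirected edge being represented by its two
  orientations. Subdivisions are those of \<^theory>\<open>Graph_Theory.Subdivision\<close>: repeatedly,
  an edge $uv$ is replaced by a path $u, w, v$ through a new vertex $w$ (zero repetitions being
  allowed), so that altogether the edges are replaced by pairwise internally disjoint paths of
  arbitrary length at least one. The original and the subdivided graph have the same vertex type,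
  the branch vertices keeping their names; \<open>K\<^bsub>4\<^esub> K\<close> allows every four-element vertex
  set, so nothing is lost by this.
\<close>

definition proper_colouring :: "'a pair_pre_digraph \<Rightarrow> nat \<Rightarrow> ('a \<Rightarrow> nat) \<Rightarrow> bool" where
  "proper_colouring G k c \<longleftrightarrow>
     c ` pverts G \<subseteq> {..<k} \<and> (\<forall>(u, v) \<in> parcs G. c u \<noteq> c v)"

text \<open>For a finite loop-free graph the minimum below is over a nonempty set.\<close>

definition chromatic_number :: "'a pair_pre_digraph \<Rightarrow> nat" where
  "chromatic_number G = (LEAST k. \<exists>c. proper_colouring G k c)"

lemma (in pair_graph) ex_proper_colouring: "\<exists>c. proper_colouring G (card (pverts G)) c"
proof -
  obtain c where c: "bij_betw c (pverts G) {0..<card (pverts G)}"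
    using ex_bij_betw_finite_nat[OF pair_finite_verts] by blast
  have "c u \<noteq> c v" if "(u, v) \<in> parcs G" for u v
    using bij_betw_imp_inj_on[OF c] in_arcsD1[OF that] in_arcsD2[OF that] no_loops'[OF that]
    by (meson inj_on_eq_iff)
  moreover have "c ` pverts G \<subseteq> {..<card (pverts G)}"
    using bij_betw_imp_surj_on[OF c] by (simp only: lessThan_atLeast0 order_refl)
  ultimately show ?thesis
    unfolding proper_colouring_def by blast
qed

lemma (in pair_graph) chromatic_number_le_iff:
  "chromatic_number G \<le> k \<longleftrightarrow> (\<exists>c. proper_colouring G k c)"
proof
  have "\<exists>c. proper_colouring G (chromatic_number G) c"
    unfolding chromatic_number_def
    by (rule LeastI[where P = "\<lambda>k. \<exists>c. proper_colouring G k c", OF ex_proper_colouring])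
  then obtain c where c: "proper_colouring G (chromatic_number G) c" ..
  assume le: "chromatic_number G \<le> k"
  have "c ` pverts G \<subseteq> {..<k}"
    using c le unfolding proper_colouring_def by (meson lessThan_subset_iff order_trans)
  with c have "proper_colouring G k c"
    unfolding proper_colouring_def by (elim conjE) (intro conjI)
  then show "\<exists>c. proper_colouring G k c"
    by (intro exI[where x = c])
next
  assume "\<exists>c. proper_colouring G k c"
  then show "chromatic_number G \<le> k"
    unfolding chromatic_number_def
    by (rule Least_le[where P = "\<lambda>k. \<exists>c. proper_colouring G k c"])
qed

end

theory Submission
  imports Defs
begin

text \<open>
  Split every component into the distance layers $N_k$ from a root. It suffices that each layer is
  bipartite: two colours for the even layers and two for the odd ones then colour $G$. As there are
  no triangles, it is enough that a layer contains no induced cycle of length at least five.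

  Let $C$ be an induced cycle and $Z$ a connected set disjoint from it. If exactly three vertices of
  $C$ have a neighbour in $Z$, one each, then $C$ and an induced subdivided claw in $Z$ form an
  induced subdivision of $K_4$. There is also one if a vertex $v$ of $C$ has one or two neighbours
  in $Z$ and exactly two further vertices $s_1, s_2$ of $C$ have a neighbour in $Z$, one each, where
  $v, s_1$ are not adjacent: either a connected part of $Z$ reduces this to the first case, or a
  path in $Z$ through both neighbours of $v$ replaces the arc of $C$ from $s_1$ to $s_2$ through
  $v$, and the part of that arc between $v$ and $s_2$ is attached to the new cycle.

  Let $C$ be an induced cycle of length at least five in $N_k$, and call the neighbours in $N_{k-1}$
  of a vertex its parents. Parents are joined by paths that descend layer by layer to the root;
  beyond the parents these send no edges to $C$, and a vertex of $N_{k-1}$ has at most one neighbour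
  on each of them. By the first case, some parent $v$ has two neighbours on $C$, and by the second,
  a shortest arc of $C$ whose ends have a common parent $v$ is of the form $a_1, s, a_2$. Let
  $x, a_1, s, a_2, y$ be consecutive on $C$. The square $v, a_1, s, a_2$ shows that a parent $w$ of
  $s$ is adjacent to neither $x$ nor $y$, that parents $q$ of $y$ are adjacent to $a_1$ and that
  parents $p$ of $x$ are adjacent to $a_2$. The cycle $q, a_1, s, a_2, y$ with $w$ attached at $s$
  and $p$ attached at $a_2$ then yields the contradiction.
\<close>

section \<open>Vertex lists as paths and cycles\<close>

fun path_arcs :: "'a list \<Rightarrow> ('a \<times> 'a) set" where
  "path_arcs (x # y # zs) = {(x, y), (y, x)} \<union> path_arcs (y # zs)"
| "path_arcs _ = {}"

definition cycle_arcs :: "'a list \<Rightarrow> ('a \<times> 'a) set" where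
  "cycle_arcs xs = path_arcs (xs @ [hd xs])"

lemma path_arcs_subset: "path_arcs xs \<subseteq> set xs \<times> set xs"
  by (induction xs rule: path_arcs.induct) auto

lemma path_arcs_append:
  assumes "xs \<noteq> []" "ys \<noteq> []"
  shows "path_arcs (xs @ ys)
    = path_arcs xs \<union> path_arcs ys \<union> {(last xs, hd ys), (hd ys, last xs)}"
  using assms
proof (induction xs rule: path_arcs.induct)
  case ("2_2" x) then show ?case by (cases ys) auto
qed auto

lemma path_arcs_Cons:
  "xs \<noteq> [] \<Longrightarrow> path_arcs (x # xs) = {(x, hd xs), (hd xs, x)} \<union> path_arcs xs"
  by (cases xs) auto

lemma path_arcs_append_Cons:
  "path_arcs (xs @ y # ys) = path_arcs (xs @ [y]) \<union> path_arcs (y # ys)"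
  by (induction xs rule: path_arcs.induct) auto

lemma path_arcs_rev [simp]: "path_arcs (rev xs) = path_arcs xs"
proof (induction xs)
  case (Cons x xs)
  then show ?case
    by (cases "xs = []") (auto simp: path_arcs_append path_arcs_Cons last_rev)
qed simp

lemma path_arcs_map_upt:
  "path_arcs (map f [0..<Suc n]) = (\<Union>i<n. {(f i, f (Suc i)), (f (Suc i), f i)})"
proof (induction n)
  case (Suc n)
  have "path_arcs (map f [0..<Suc (Suc n)])
      = path_arcs (map f [0..<Suc n]) \<union> {(f n, f (Suc n)), (f (Suc n), f n)}"
    using path_arcs_append[of "map f [0..<Suc n]" "[f (Suc n)]"] by simp
  then show ?case unfolding Suc.IH lessThan_Suc by blast
qed simp

lemma path_arcs_connected:
  "u \<in> set xs \<Longrightarrow> v \<in> set xs \<Longrightarrow> (u, v) \<in> (path_arcs xs)\<^sup>*"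
proof (induction xs arbitrary: u v rule: path_arcs.induct)
  case (1 x y zs)
  let ?B = "path_arcs (x # y # zs)"
  have mono: "(path_arcs (y # zs))\<^sup>* \<subseteq> ?B\<^sup>*" by (rule rtrancl_mono) auto
  have "(y, w) \<in> ?B\<^sup>*" "(w, y) \<in> ?B\<^sup>*" if "w \<in> set (x # y # zs)" for w
    using that "1.IH"[of y w] "1.IH"[of w y] mono by auto
  with "1.prems" show ?case by (meson rtrancl_trans)
qed auto

lemma set_subset_Field_path_arcs: "2 \<le> length xs \<Longrightarrow> set xs \<subseteq> Field (path_arcs xs)"
proof (induction xs rule: path_arcs.induct)
  case (1 x y zs)
  then show ?case by (cases zs) (auto simp: Field_def)
qed auto

lemma path_arcs_between_ends:
  assumes "(x, y) \<in> path_arcs (a # I @ [b])" "x \<notin> set I" "y \<notin> set I" "a \<noteq> b" "{a, b} \<inter> set I = {}"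
  shows "{x, y} = {a, b}"
proof (cases "I = []")
  case False
  then have "path_arcs (a # I @ [b])
      = {(a, hd I), (hd I, a), (last I, b), (b, last I)} \<union> path_arcs I"
    by (simp add: path_arcs_Cons path_arcs_append insert_commute Un_commute)
  then show ?thesis
    using assms False path_arcs_subset[of I] by auto
qed (use assms in auto)

lemma cycle_arcs_subset: "cycle_arcs xs \<subseteq> set xs \<times> set xs"
  using path_arcs_subset[of "xs @ [hd xs]"] by (cases xs) (auto simp: cycle_arcs_def)

lemma cycle_arcs_append:
  assumes "xs \<noteq> []" "ys \<noteq> []"
  shows "cycle_arcs (xs @ ys) = path_arcs xs \<union> path_arcs ys
    \<union> {(last xs, hd ys), (hd ys, last xs), (last ys, hd xs), (hd xs, last ys)}"
  using assms path_arcs_append[of "xs @ ys" "[hd xs]"] path_arcs_append[of xs ys]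
  by (auto simp: cycle_arcs_def)

lemma cycle_arcs_rotate: "cycle_arcs (xs @ ys) = cycle_arcs (ys @ xs)"
  by (cases "xs = [] \<or> ys = []") (auto simp: cycle_arcs_append)

lemma cycle_arcs_rev: "cycle_arcs (rev xs) = cycle_arcs xs"
proof (cases xs)
  case (Cons x ys)
  have "path_arcs (x # ys @ [x]) = path_arcs (x # rev ys @ [x])"
    using path_arcs_rev[of "x # ys @ [x]"] by simp
  then have "cycle_arcs ([x] @ rev ys) = cycle_arcs ([x] @ ys)"
    by (simp add: cycle_arcs_def)
  then show ?thesis by (simp add: Cons cycle_arcs_rotate[of "rev ys"])
qed simp

section \<open>Subdivisions of the complete graph on four vertices\<close>

lemma subdivision_pair_path:
  assumes "subdivision_pair K \<lparr>pverts = S, parcs = B \<union> {(a, b), (b, a)}\<rparr>"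
    and "(a, b) \<notin> B" "(b, a) \<notin> B" "B \<subseteq> S \<times> S" "a \<in> S" "b \<in> S" "a \<noteq> b"
    and "distinct I" "set I \<inter> S = {}"
  shows "subdivision_pair K \<lparr>pverts = S \<union> set I, parcs = B \<union> path_arcs (a # I @ [b])\<rparr>"
  using assms
proof (induction I arbitrary: a S B)
  case Nil
  then show ?case by simp
next
  case (Cons x I)
  let ?H = "\<lparr>pverts = S, parcs = B \<union> {(a, b), (b, a)}\<rparr>"
  have fresh: "x \<notin> S" "x \<noteq> a" "x \<noteq> b" using Cons.prems by auto
  have "subdivide ?H (a, b) x
      = \<lparr>pverts = insert x S, parcs = (B \<union> {(a, x), (x, a)}) \<union> {(x, b), (b, x)}\<rparr>"
    using Cons.prems(2,3) by (auto simp: subdivide.simps)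
  moreover have "subdivision_pair K (subdivide ?H (a, b) x)"
    by (rule subdivision_pair_divide) (use Cons.prems fresh in auto)
  ultimately have "subdivision_pair K
      \<lparr>pverts = insert x S, parcs = (B \<union> {(a, x), (x, a)}) \<union> {(x, b), (b, x)}\<rparr>"
    by (simp only:)
  then have "subdivision_pair K \<lparr>pverts = insert x S \<union> set I,
      parcs = (B \<union> {(a, x), (x, a)}) \<union> path_arcs (x # I @ [b])\<rparr>"
    by (rule Cons.IH) (use Cons.prems fresh in auto)
  then show ?case by (simp add: insert_commute Un_assoc)
qed

text \<open>A triple \<open>(a, I, b)\<close> stands for the path from \<open>a\<close> to \<open>b\<close> with list \<open>I\<close> of inner vertices.\<close>

definition inner_vertices :: "('a \<times> 'a list \<times> 'a) list \<Rightarrow> 'a list" where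
  "inner_vertices ps = concat (map (\<lambda>(a, I, b). I) ps)"

definition edge_arcs :: "('a \<times> 'a list \<times> 'a) list \<Rightarrow> ('a \<times> 'a) set" where
  "edge_arcs ps = (\<Union>(a, I, b)\<in>set ps. path_arcs [a, b])"

definition subdivided_arcs :: "('a \<times> 'a list \<times> 'a) list \<Rightarrow> ('a \<times> 'a) set" where
  "subdivided_arcs ps = (\<Union>(a, I, b)\<in>set ps. path_arcs (a # I @ [b]))"

lemma subdivided_arcs_subset:
  assumes "\<forall>(a, I, b)\<in>set ps. a \<in> S \<and> b \<in> S \<and> a \<noteq> b"
  shows "subdivided_arcs ps \<subseteq> (S \<union> set (inner_vertices ps)) \<times> (S \<union> set (inner_vertices ps))"
proof -
  have "set (a # I @ [b]) \<subseteq> S \<union> set (inner_vertices ps)" if "(a, I, b) \<in> set ps" for a I b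
    using that assms by (force simp: inner_vertices_def)
  then have "path_arcs (a # I @ [b])
      \<subseteq> (S \<union> set (inner_vertices ps)) \<times> (S \<union> set (inner_vertices ps))"
    if "(a, I, b) \<in> set ps" for a I b
    using that path_arcs_subset[of "a # I @ [b]"] by blast
  then show ?thesis unfolding subdivided_arcs_def by blast
qed

lemma subset_Field_subdivided_arcs:
  "(\<Union>(a, I, b)\<in>set ps. set (a # I @ [b])) \<subseteq> Field (subdivided_arcs ps)"
proof clarify
  fix a I b x assume path: "(a, I, b) \<in> set ps" and on_path: "x \<in> set (a # I @ [b])"
  have "path_arcs (a # I @ [b]) \<subseteq> subdivided_arcs ps" using path by (auto simp: subdivided_arcs_def)
  then have "Field (path_arcs (a # I @ [b])) \<subseteq> Field (subdivided_arcs ps)" by (rule mono_Field)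
  moreover have "x \<in> Field (path_arcs (a # I @ [b]))"
    using on_path set_subset_Field_path_arcs[of "a # I @ [b]"] by (simp add: subset_iff) blast
  ultimately show "x \<in> Field (subdivided_arcs ps)" by (rule subsetD)
qed

lemma subdivided_arcs_between_branch_vertices:
  assumes "(x, y) \<in> subdivided_arcs ps" "x \<in> S" "y \<in> S"
    and "\<forall>(a, I, b)\<in>set ps. a \<in> S \<and> b \<in> S \<and> a \<noteq> b" "set (inner_vertices ps) \<inter> S = {}"
  shows "{x, y} \<in> (\<lambda>(a, I, b). {a, b}) ` set ps"
proof -
  obtain a I b where path: "(a, I, b) \<in> set ps" "(x, y) \<in> path_arcs (a # I @ [b])"
    using assms(1) by (auto simp: subdivided_arcs_def)
  have "a \<in> S" "b \<in> S" "a \<noteq> b" using assms(4) path(1) by auto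
  moreover have "set I \<subseteq> set (inner_vertices ps)" using path(1) by (force simp: inner_vertices_def)
  ultimately have "{x, y} = {a, b}"
    using assms(2,3,5) by (intro path_arcs_between_ends[OF path(2)]) auto
  with path(1) show ?thesis by force
qed

lemma subdivision_pair_paths:
  assumes "subdivision_pair K \<lparr>pverts = S, parcs = B \<union> edge_arcs ps\<rparr>"
    and "B \<subseteq> S \<times> S" "B \<inter> edge_arcs ps = {}"
    and "\<forall>(a, I, b)\<in>set ps. a \<in> S \<and> b \<in> S \<and> a \<noteq> b"
    and "distinct (map (\<lambda>(a, I, b). {a, b}) ps)"
    and "distinct (inner_vertices ps)" "set (inner_vertices ps) \<inter> S = {}"
  shows "subdivision_pair K
    \<lparr>pverts = S \<union> set (inner_vertices ps), parcs = B \<union> subdivided_arcs ps\<rparr>"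
  using assms
proof (induction ps arbitrary: B)
  case Nil
  then show ?case by (simp add: inner_vertices_def edge_arcs_def subdivided_arcs_def)
next
  case (Cons p ps)
  obtain a I b where p_eq: "p = (a, I, b)" by (cases p)
  let ?J = "inner_vertices ps" and ?e = "{(a, b), (b, a)}"
  have edges: "edge_arcs (p # ps) = ?e \<union> edge_arcs ps"
    and paths: "subdivided_arcs (p # ps) = path_arcs (a # I @ [b]) \<union> subdivided_arcs ps"
    and inner: "inner_vertices (p # ps) = I @ ?J"
    by (auto simp: p_eq edge_arcs_def subdivided_arcs_def inner_vertices_def)
  have ab: "a \<in> S" "b \<in> S" "a \<noteq> b" and rest: "\<forall>(a, I, b)\<in>set ps. a \<in> S \<and> b \<in> S \<and> a \<noteq> b"
    using Cons.prems(4) by (auto simp: p_eq)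
  have I: "distinct I" "set I \<inter> (S \<union> set ?J) = {}" and J: "distinct ?J" "set ?J \<inter> S = {}"
    using Cons.prems(6,7) unfolding inner by auto
  have new: "{a, b} \<notin> (\<lambda>(a, I, b). {a, b}) ` set ps"
    using Cons.prems(5) by (simp add: p_eq)
  then have "?e \<inter> edge_arcs ps = {}"
    by (force simp: edge_arcs_def insert_commute)
  then have "subdivision_pair K
      \<lparr>pverts = S \<union> set ?J, parcs = (B \<union> ?e) \<union> subdivided_arcs ps\<rparr>"
    using Cons.prems(1,2,3,5) ab rest J by (intro Cons.IH) (auto simp: edges Un_assoc)
  then have "subdivision_pair K
      \<lparr>pverts = S \<union> set ?J, parcs = (B \<union> subdivided_arcs ps) \<union> ?e\<rparr>"
    by (simp only: Un_ac)
  then have "subdivision_pair K \<lparr>pverts = (S \<union> set ?J) \<union> set I,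
      parcs = (B \<union> subdivided_arcs ps) \<union> path_arcs (a # I @ [b])\<rparr>"
  proof (rule subdivision_pair_path)
    show "(a, b) \<notin> B \<union> subdivided_arcs ps" "(b, a) \<notin> B \<union> subdivided_arcs ps"
      using subdivided_arcs_between_branch_vertices[OF _ ab(1,2) rest J(2)]
        subdivided_arcs_between_branch_vertices[OF _ ab(2,1) rest J(2)] new Cons.prems(3)
      by (auto simp: edges insert_commute)
    show "B \<union> subdivided_arcs ps \<subseteq> (S \<union> set ?J) \<times> (S \<union> set ?J)"
      using Cons.prems(2) subdivided_arcs_subset[OF rest] by blast
  qed (use ab I in auto)
  then show ?case by (simp only: inner paths set_append Un_ac)
qed

text \<open>
  A relation does not record isolated vertices; a subdivision of $K_4$ has none, so its vertices
  lie in the field.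
\<close>

definition has_isk4 :: "('a \<times> 'a) set \<Rightarrow> bool" where
  "has_isk4 A \<longleftrightarrow> (\<exists>K H. K\<^bsub>4\<^esub> (with_proj K) \<and> subdivision_pair K H
     \<and> pverts H \<subseteq> Field A \<and> parcs H = Restr A (pverts H))"

lemma has_isk4I:
  assumes dist: "distinct ([a, b, c, d] @ Iab @ Iac @ Iad @ Ibc @ Ibd @ Icd)"
    and S: "S = set ([a, b, c, d] @ Iab @ Iac @ Iad @ Ibc @ Ibd @ Icd)"
    and arcs: "Restr A S = path_arcs (a # Iab @ [b]) \<union> path_arcs (a # Iac @ [c])
       \<union> path_arcs (a # Iad @ [d]) \<union> path_arcs (b # Ibc @ [c]) \<union> path_arcs (b # Ibd @ [d])
       \<union> path_arcs (c # Icd @ [d])"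
  shows "has_isk4 A"
proof -
  let ?V = "{a, b, c, d}"
  let ?ps = "[(a, Iab, b), (a, Iac, c), (a, Iad, d), (b, Ibc, c), (b, Ibd, d), (c, Icd, d)]"
  define K where "K = \<lparr>pverts = ?V, parcs = {(x, y). (x, y) \<in> ?V \<times> ?V \<and> x \<noteq> y}\<rparr>"
  have K4: "K\<^bsub>4\<^esub> (with_proj K)"
    unfolding complete_digraph_pair_def K_def using dist by auto
  then interpret pair_graph K by (rule pair_graphI_complete)
  have "subdivision_pair K K" by (rule subdivision_pair_base) unfold_locales
  moreover have "K = \<lparr>pverts = ?V, parcs = {} \<union> edge_arcs ?ps\<rparr>"
    using dist by (auto simp: K_def edge_arcs_def)
  ultimately have "subdivision_pair K \<lparr>pverts = ?V, parcs = {} \<union> edge_arcs ?ps\<rparr>" by simp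
  then have "subdivision_pair K \<lparr>pverts = ?V \<union> set (inner_vertices ?ps),
      parcs = {} \<union> subdivided_arcs ?ps\<rparr>"
    by (rule subdivision_pair_paths) (use dist in \<open>auto simp: doubleton_eq_iff inner_vertices_def\<close>)
  moreover have "?V \<union> set (inner_vertices ?ps) = S"
    using S by (auto simp: inner_vertices_def)
  moreover have arcs_eq: "subdivided_arcs ?ps = Restr A S"
    unfolding arcs by (auto simp: subdivided_arcs_def)
  ultimately have subdiv: "subdivision_pair K \<lparr>pverts = S, parcs = Restr A S\<rparr>"
    by (simp only: Un_empty_left)
  have "S \<subseteq> (\<Union>(a, I, b)\<in>set ?ps. set (a # I @ [b]))"
    unfolding S by auto
  also have "\<dots> \<subseteq> Field (subdivided_arcs ?ps)" by (rule subset_Field_subdivided_arcs)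
  also have "\<dots> \<subseteq> Field A" unfolding arcs_eq by (rule mono_Field) blast
  finally have "S \<subseteq> Field A" .
  with K4 subdiv show ?thesis unfolding has_isk4_def by fastforce
qed

section \<open>Induced paths, induced cycles and connected sets\<close>

definition induced_path :: "('a \<times> 'a) set \<Rightarrow> 'a list \<Rightarrow> bool" where
  "induced_path A xs \<longleftrightarrow> xs \<noteq> [] \<and> distinct xs \<and> Restr A (set xs) = path_arcs xs"

definition induced_cycle :: "('a \<times> 'a) set \<Rightarrow> 'a list \<Rightarrow> bool" where
  "induced_cycle A xs \<longleftrightarrow> 3 \<le> length xs \<and> distinct xs \<and> Restr A (set xs) = cycle_arcs xs"

definition connected_set :: "('a \<times> 'a) set \<Rightarrow> 'a set \<Rightarrow> bool" where
  "connected_set A Z \<longleftrightarrow> (\<forall>x\<in>Z. \<forall>y\<in>Z. (x, y) \<in> (Restr A Z)\<^sup>*)"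

lemma induced_path_nonempty: "induced_path A P \<Longrightarrow> P \<noteq> []"
  by (simp add: induced_path_def)

lemma induced_path_rev [simp]: "induced_path A (rev P) \<longleftrightarrow> induced_path A P"
  by (simp add: induced_path_def)

lemma induced_cycle_rev [simp]: "induced_cycle A (rev C) \<longleftrightarrow> induced_cycle A C"
  by (simp add: induced_cycle_def cycle_arcs_rev)

lemma induced_cycle_rotate: "induced_cycle A (xs @ ys) \<longleftrightarrow> induced_cycle A (ys @ xs)"
  by (auto simp: induced_cycle_def cycle_arcs_rotate[of xs] Un_commute)

lemma induced_cycle_through_three:
  assumes "induced_cycle A C" "{x, y, z} \<subseteq> set C" "x \<noteq> y" "x \<noteq> z" "y \<noteq> z"
  obtains I1 I2 I3 where "induced_cycle A (x # I1 @ y # I2 @ z # I3)"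
    "set (x # I1 @ y # I2 @ z # I3) = set C"
proof -
  obtain C1 C2 where C: "C = C1 @ x # C2" using assms(2) by (meson insert_subset split_list)
  define P where "P = C2 @ C1"
  have P: "induced_cycle A (x # P)" "set (x # P) = set C"
    using assms(1) induced_cycle_rotate[of A C1 "x # C2"] by (auto simp: C P_def)
  have "induced_cycle A (x # rev P)"
    using P(1) induced_cycle_rotate[of A "[x]" "rev P"] induced_cycle_rev[of A "x # P"] by simp
  have yz: "y \<in> set P" "z \<in> set P" using P(2) assms(2-4) by (auto dest!: equalityD2)
  then obtain P1 P2 where P12: "P = P1 @ y # P2" by (meson split_list)
  with yz assms(5) consider (after) "z \<in> set P2" | (before) "z \<in> set P1" by auto
  then show thesis
  proof cases
    case after
    then obtain P3 P4 where "P2 = P3 @ z # P4" by (meson split_list)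
    with P show thesis by (intro that[of P1 P3 P4]) (auto simp: P12)
  next
    case before
    then obtain P3 P4 where "P1 = P3 @ z # P4" by (meson split_list)
    with P \<open>induced_cycle A (x # rev P)\<close> show thesis
      by (intro that[of "rev P2" "rev P4" "rev P3"]) (auto simp: P12)
  qed
qed

lemma connected_set_singleton: "connected_set A {x}"
  by (simp add: connected_set_def)

lemma connected_set_induced_path: "induced_path A P \<Longrightarrow> connected_set A (set P)"
  by (simp add: connected_set_def induced_path_def path_arcs_connected)

locale simple_graph =
  fixes A :: "('a \<times> 'a) set"
  assumes adj_sym: "(x, y) \<in> A \<Longrightarrow> (y, x) \<in> A"
    and adj_irrefl: "(x, x) \<notin> A"
begin

lemma adj_commute: "(x, y) \<in> A \<longleftrightarrow> (y, x) \<in> A"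
  using adj_sym by blast

lemma Restr_Un_eq_iff:
  assumes "S \<inter> T = {}" "B \<subseteq> S \<times> S" "D \<subseteq> T \<times> T" "C \<subseteq> S \<times> T"
  shows "Restr A (S \<union> T) = B \<union> D \<union> (C \<union> C\<inverse>)
    \<longleftrightarrow> Restr A S = B \<and> Restr A T = D \<and> (\<forall>x\<in>S. \<forall>y\<in>T. (x, y) \<in> A \<longleftrightarrow> (x, y) \<in> C)"
    (is "?L \<longleftrightarrow> ?R")
proof
  assume ?L
  then have arcs: "(x, y) \<in> A \<longleftrightarrow> (x, y) \<in> B \<union> D \<union> (C \<union> C\<inverse>)" if "x \<in> S \<union> T" "y \<in> S \<union> T" for x y
    using that by blast
  have "Restr A S = B" using arcs assms by blast
  moreover have "Restr A T = D" using arcs assms by blast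
  moreover have "(x, y) \<in> A \<longleftrightarrow> (x, y) \<in> C" if "x \<in> S" "y \<in> T" for x y
    using arcs[of x y] assms that by blast
  ultimately show ?R by blast
next
  assume ?R
  then show ?L using assms(4) adj_sym by blast
qed

lemma induced_path_append:
  assumes "xs \<noteq> []" "ys \<noteq> []"
  shows "induced_path A (xs @ ys) \<longleftrightarrow> induced_path A xs \<and> induced_path A ys \<and> set xs \<inter> set ys = {}
    \<and> (\<forall>x\<in>set xs. \<forall>y\<in>set ys. (x, y) \<in> A \<longleftrightarrow> x = last xs \<and> y = hd ys)"
proof (cases "set xs \<inter> set ys = {}")
  case True
  have "path_arcs (xs @ ys)
      = path_arcs xs \<union> path_arcs ys \<union> ({(last xs, hd ys)} \<union> {(last xs, hd ys)}\<inverse>)"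
    using assms by (auto simp: path_arcs_append)
  moreover have "{(last xs, hd ys)} \<subseteq> set xs \<times> set ys" using assms by simp
  ultimately have "Restr A (set (xs @ ys)) = path_arcs (xs @ ys)
      \<longleftrightarrow> Restr A (set xs) = path_arcs xs \<and> Restr A (set ys) = path_arcs ys
        \<and> (\<forall>x\<in>set xs. \<forall>y\<in>set ys. (x, y) \<in> A \<longleftrightarrow> (x, y) \<in> {(last xs, hd ys)})"
    using Restr_Un_eq_iff[OF True path_arcs_subset path_arcs_subset] by (simp only: set_append)
  then show ?thesis
    using True assms by (auto simp: induced_path_def)
qed (auto simp: induced_path_def)

lemma induced_cycle_append:
  assumes "xs \<noteq> []" "ys \<noteq> []"
  shows "induced_cycle A (xs @ ys) \<longleftrightarrow>
    3 \<le> length xs + length ys \<and> induced_path A xs \<and> induced_path A ys \<and> set xs \<inter> set ys = {}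
    \<and> (\<forall>x\<in>set xs. \<forall>y\<in>set ys.
        (x, y) \<in> A \<longleftrightarrow> x = last xs \<and> y = hd ys \<or> x = hd xs \<and> y = last ys)"
proof (cases "set xs \<inter> set ys = {}")
  case True
  let ?C = "{(last xs, hd ys), (hd xs, last ys)}"
  have "cycle_arcs (xs @ ys) = path_arcs xs \<union> path_arcs ys \<union> (?C \<union> ?C\<inverse>)"
    using assms by (auto simp: cycle_arcs_append)
  moreover have "?C \<subseteq> set xs \<times> set ys" using assms by simp
  ultimately have "Restr A (set (xs @ ys)) = cycle_arcs (xs @ ys)
      \<longleftrightarrow> Restr A (set xs) = path_arcs xs \<and> Restr A (set ys) = path_arcs ys
        \<and> (\<forall>x\<in>set xs. \<forall>y\<in>set ys. (x, y) \<in> A \<longleftrightarrow> (x, y) \<in> ?C)"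
    using Restr_Un_eq_iff[OF True path_arcs_subset path_arcs_subset] by (simp only: set_append)
  then show ?thesis
    using True assms by (auto simp: induced_cycle_def induced_path_def)
qed (auto simp: induced_cycle_def)

lemma induced_cycle_cross:
  assumes "induced_cycle A (xs @ ys)" "xs \<noteq> []" "ys \<noteq> []" "x \<in> set xs" "y \<in> set ys"
  shows "(x, y) \<in> A \<longleftrightarrow> x = last xs \<and> y = hd ys \<or> x = hd xs \<and> y = last ys"
  using assms induced_cycle_append[of xs ys] by blast

lemma induced_path_single [simp]: "induced_path A [x]"
  by (auto simp: induced_path_def adj_irrefl)

lemma induced_path_Cons:
  assumes "P \<noteq> []"
  shows "induced_path A (x # P) \<longleftrightarrow>
    induced_path A P \<and> x \<notin> set P \<and> (\<forall>y\<in>set P. (x, y) \<in> A \<longleftrightarrow> y = hd P)"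
  using induced_path_append[of "[x]" P] assms by auto

lemma induced_cycle_Cons:
  assumes "2 \<le> length P"
  shows "induced_cycle A (x # P) \<longleftrightarrow>
    induced_path A P \<and> x \<notin> set P \<and> (\<forall>y\<in>set P. (x, y) \<in> A \<longleftrightarrow> y = hd P \<or> y = last P)"
  using induced_cycle_append[of "[x]" P] assms by (cases P) auto

lemma induced_path_prefix: "induced_path A (xs @ ys) \<Longrightarrow> xs \<noteq> [] \<Longrightarrow> induced_path A xs"
  using induced_path_append[of xs ys] by (cases "ys = []") auto

lemma induced_path_suffix: "induced_path A (xs @ ys) \<Longrightarrow> ys \<noteq> [] \<Longrightarrow> induced_path A ys"
  using induced_path_append[of xs ys] by (cases "xs = []") auto

lemma induced_cycle_proper_prefix:
  "induced_cycle A (xs @ ys) \<Longrightarrow> xs \<noteq> [] \<Longrightarrow> ys \<noteq> [] \<Longrightarrow> induced_path A xs"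
  using induced_cycle_append[of xs ys] by blast

lemma induced_path_replace_middle:
  assumes "induced_path A (xs @ ms @ ys)" "xs \<noteq> []" "ms \<noteq> []" "ys \<noteq> []"
    and "y \<notin> set xs \<union> set ys"
    and "\<And>x. x \<in> set xs \<union> set ys \<Longrightarrow> (x, y) \<in> A \<longleftrightarrow> x = last xs \<or> x = hd ys"
  shows "induced_path A (xs @ y # ys)"
proof -
  have xs: "induced_path A xs" and ys: "induced_path A ys"
    using assms(1-4) induced_path_prefix[of xs "ms @ ys"] induced_path_suffix[of "xs @ ms" ys]
    by auto
  have nonadj: "x \<notin> set ys \<and> (x, z) \<notin> A" if "x \<in> set xs" "z \<in> set ys" for x z
  proof -
    have "z \<noteq> hd ms" using assms(1) that hd_in_set[OF assms(3)] by (auto simp: induced_path_def)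
    then show ?thesis using assms(1-3) that induced_path_append[of xs "ms @ ys"] by auto
  qed
  have "induced_path A (y # ys)"
    using ys assms(4-6) nonadj last_in_set[OF assms(2)] adj_commute[of y]
    by (auto simp: induced_path_Cons)
  moreover have "(x, z) \<in> A \<longleftrightarrow> x = last xs \<and> z = y" if "x \<in> set xs" "z \<in> set (y # ys)" for x z
  proof -
    have "x \<noteq> hd ys" using nonadj[OF that(1), of "hd ys"] assms(4) by auto
    then show ?thesis using that assms(5,6) nonadj[OF that(1), of z] by auto
  qed
  ultimately show ?thesis
    using xs assms(2,5) nonadj by (auto simp: induced_path_append)
qed

lemma rtrancl_obtain_induced_path:
  assumes "(x, y) \<in> (Restr A Z)\<^sup>*" "y \<in> Z"
  obtains P where "induced_path A P" "hd P = x" "last P = y" "set P \<subseteq> Z"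
proof -
  have "\<exists>P. induced_path A P \<and> hd P = x \<and> last P = y \<and> set P \<subseteq> Z"
    using assms(1)
  proof (induction rule: converse_rtrancl_induct)
    case base
    show ?case using assms(2) by (intro exI[of _ "[y]"]) auto
  next
    case (step x w)
    then obtain P where P: "induced_path A P" "hd P = w" "last P = y" "set P \<subseteq> Z" by blast
    show ?case
    proof (cases "x \<in> set P")
      case True
      then obtain P1 P2 where "P = P1 @ x # P2" by (meson split_list)
      with P show ?thesis
        using induced_path_suffix[of P1 "x # P2"] by (intro exI[of _ "x # P2"]) auto
    next
      case False
      have "w \<in> set P" using P(2) induced_path_nonempty[OF P(1)] by auto
      then have "\<exists>r\<in>set P. (x, r) \<in> A" using step.hyps by auto
      then obtain P1 r P2 where last_nbr: "P = P1 @ r # P2" "(x, r) \<in> A" "\<forall>u\<in>set P2. (x, u) \<notin> A"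
        by (rule split_list_last_propE) blast
      have "induced_path A (r # P2)" using induced_path_suffix P(1) last_nbr(1) by blast
      then have "induced_path A (x # r # P2)"
        using last_nbr False by (auto simp: induced_path_Cons)
      then show ?thesis using P last_nbr step.hyps by (intro exI[of _ "x # r # P2"]) auto
    qed
  qed
  then show thesis using that by blast
qed

lemma connected_set_obtain_induced_path:
  assumes "connected_set A Z" "x \<in> Z" "y \<in> Z"
  obtains P where "induced_path A P" "hd P = x" "last P = y" "set P \<subseteq> Z"
  using assms rtrancl_obtain_induced_path unfolding connected_set_def by metis

lemma connected_set_Union:
  assumes "\<And>S. S \<in> F \<Longrightarrow> connected_set A S \<and> r \<in> S"
  shows "connected_set A (\<Union>F)"
proof -
  have "(u, r) \<in> (Restr A (\<Union>F))\<^sup>*" "(r, u) \<in> (Restr A (\<Union>F))\<^sup>*" if "u \<in> \<Union>F" for u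
  proof -
    from that obtain S where S: "S \<in> F" "u \<in> S" by blast
    then have "(Restr A S)\<^sup>* \<subseteq> (Restr A (\<Union>F))\<^sup>*" by (intro rtrancl_mono) blast
    then show "(u, r) \<in> (Restr A (\<Union>F))\<^sup>*" "(r, u) \<in> (Restr A (\<Union>F))\<^sup>*"
      using assms[OF S(1)] S(2) unfolding connected_set_def by blast+
  qed
  then show ?thesis unfolding connected_set_def by (meson rtrancl_trans)
qed

lemma connected_set_Un:
  assumes "connected_set A S" "connected_set A T" "x \<in> S" "x \<in> T"
  shows "connected_set A (S \<union> T)"
  using connected_set_Union[of "{S, T}" x] assms by auto

lemma connected_set_insert:
  assumes "connected_set A S" "x \<in> S" "(x, y) \<in> A"
  shows "connected_set A (insert y S)"
proof -
  have "connected_set A {x, y}"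
    using assms(3) adj_sym by (auto simp: connected_set_def intro!: r_into_rtrancl)
  moreover have "S \<union> {x, y} = insert y S" using assms(2) by auto
  ultimately show ?thesis using connected_set_Un[OF assms(1) _ assms(2), of "{x, y}"] by simp
qed

text \<open>
  Start from a path between \<open>p\<close> and \<open>q\<close>. If it misses both \<open>z1\<close> and \<open>z2\<close>, add a path from \<open>p\<close>
  that stops at the first of them.
\<close>

lemma connected_set_through_one_or_path_through_both:
  assumes Z: "connected_set A Z" "{p, q, z1, z2} \<subseteq> Z"
  obtains (one) Y z where "connected_set A Y" "{p, q} \<subseteq> Y" "Y \<subseteq> Z" "Y \<inter> {z1, z2} = {z}"
    | (both) Q where "induced_path A Q" "hd Q = p" "last Q = q" "set Q \<subseteq> Z"
        "{z1, z2} \<subseteq> set Q" "z1 \<noteq> z2"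
proof -
  obtain Q where Q: "induced_path A Q" "hd Q = p" "last Q = q" "set Q \<subseteq> Z"
    using connected_set_obtain_induced_path[OF Z(1), of p q] Z(2) by auto
  have conn: "connected_set A (set Q)" using Q(1) by (rule connected_set_induced_path)
  have ends: "p \<in> set Q" "q \<in> set Q" using Q(2,3) induced_path_nonempty[OF Q(1)] by auto
  consider (two) "z1 \<noteq> z2" "{z1, z2} \<subseteq> set Q" | (one) z where "set Q \<inter> {z1, z2} = {z}"
    | (none) "set Q \<inter> {z1, z2} = {}"
    by blast
  then show thesis
  proof cases
    case two
    then show thesis using that(2) Q by blast
  next
    case (one z)
    then show thesis using that(1)[of "set Q"] conn ends Q(4) by blast
  next
    case none
    obtain R where R: "induced_path A R" "hd R = p" "last R = z1" "set R \<subseteq> Z"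
      using connected_set_obtain_induced_path[OF Z(1), of p z1] Z(2) by auto
    have "\<exists>z\<in>set R. z \<in> {z1, z2}" using R(3) induced_path_nonempty[OF R(1)] by auto
    then obtain R1 z R2 where first: "R = (R1 @ [z]) @ R2" "z \<in> {z1, z2}" "\<forall>y\<in>set R1. y \<notin> {z1, z2}"
      by (rule split_list_first_propE) auto
    let ?Y = "set Q \<union> set (R1 @ [z])"
    have "induced_path A (R1 @ [z])" using R(1) induced_path_prefix first(1) by blast
    moreover have "p \<in> set (R1 @ [z])" using R(2) first(1) by (cases R1) auto
    ultimately have "connected_set A ?Y"
      using connected_set_Un[OF conn connected_set_induced_path ends(1)] by blast
    moreover have "?Y \<inter> {z1, z2} = {z}" using none first(2,3) by auto
    ultimately show thesis using that(1)[of ?Y z] ends Q(4) R(4) first(1) by auto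
  qed
qed

end

section \<open>Attachments to an induced cycle\<close>

text \<open>
  The legs are listed from the centre \<open>z\<close> outwards and may be empty, so that their ends are
  \<open>last (z # L1)\<close>, \<open>last (z # L2)\<close> and \<open>last (z # L3)\<close>.
\<close>

definition induced_tripod :: "('a \<times> 'a) set \<Rightarrow> 'a \<Rightarrow> 'a list \<Rightarrow> 'a list \<Rightarrow> 'a list \<Rightarrow> bool" where
  "induced_tripod A z L1 L2 L3 \<longleftrightarrow> distinct (z # L1 @ L2 @ L3)
     \<and> Restr A (set (z # L1 @ L2 @ L3))
       = path_arcs (z # L1) \<union> path_arcs (z # L2) \<union> path_arcs (z # L3)"

context simple_graph
begin

lemma induced_tripodI:
  assumes "induced_path A (rev L1 @ z # L2)" "induced_path A (z # L3)"
    and "\<And>x y. x \<in> set L3 \<Longrightarrow> y \<in> set L1 \<union> set L2 \<Longrightarrow> x \<noteq> y \<and> (x, y) \<notin> A"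
  shows "induced_tripod A z L1 L2 L3"
proof -
  have "path_arcs (rev L1 @ [z]) = path_arcs (z # L1)"
    using path_arcs_rev[of "z # L1"] by simp
  then have "path_arcs (rev L1 @ z # L2) = path_arcs (z # L1) \<union> path_arcs (z # L2)"
    by (subst path_arcs_append_Cons) simp
  moreover have "Restr A (set (z # L1 @ L2 @ L3))
      = Restr A (set (rev L1 @ z # L2)) \<union> Restr A (set (z # L3))"
    using assms(3) adj_sym by auto
  moreover have "distinct (z # L1 @ L2 @ L3)"
    using assms by (auto simp: induced_path_def)
  ultimately show ?thesis
    using assms(1,2) by (simp add: induced_tripod_def induced_path_def)
qed

lemma induced_tripod_extend:
  assumes T: "induced_tripod A z L1 L2 L3" and P: "induced_path A (last (z # L3) # P)"
    and sep: "\<And>x y. x \<in> set P \<Longrightarrow> y \<in> set (z # L1 @ L2 @ L3) \<Longrightarrow>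
      x \<noteq> y \<and> ((x, y) \<in> A \<longrightarrow> y = last (z # L3))"
  shows "induced_tripod A z L1 L2 (L3 @ P)"
proof (cases "P = []")
  case False
  let ?y = "last (z # L3)" and ?T = "set (z # L1 @ L2 @ L3)"
  have y_in: "?y \<in> ?T" by auto
  have P': "induced_path A P" "\<forall>x\<in>set P. (?y, x) \<in> A \<longleftrightarrow> x = hd P"
    using P False by (auto simp: induced_path_Cons)
  have "path_arcs ((z # L3) @ P) = path_arcs (z # L3) \<union> path_arcs P \<union> {(?y, hd P), (hd P, ?y)}"
    using False by (subst path_arcs_append) auto
  moreover have "Restr A (?T \<union> set P)
      = Restr A ?T \<union> path_arcs P \<union> ({(?y, hd P)} \<union> {(?y, hd P)}\<inverse>)"
  proof (subst Restr_Un_eq_iff)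
    show "?T \<inter> set P = {}" using sep by blast
    show "{(?y, hd P)} \<subseteq> ?T \<times> set P" using y_in False by simp
    have "(x, u) \<in> A \<longleftrightarrow> x = ?y \<and> u = hd P" if "x \<in> ?T" "u \<in> set P" for x u
      using P'(2) sep[OF that(2,1)] that(2) adj_commute[of x u] by blast
    then show "Restr A ?T = Restr A ?T \<and> Restr A (set P) = path_arcs P
        \<and> (\<forall>x\<in>?T. \<forall>u\<in>set P. (x, u) \<in> A \<longleftrightarrow> (x, u) \<in> {(?y, hd P)})"
      using P'(1) by (simp add: induced_path_def)
  qed (auto simp: path_arcs_subset)
  moreover have "set (z # L1 @ L2 @ L3 @ P) = ?T \<union> set P" by auto
  moreover have "distinct (z # L1 @ L2 @ L3 @ P)"
    using T P'(1) sep by (auto simp: induced_tripod_def induced_path_def)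
  ultimately show ?thesis
    using T unfolding induced_tripod_def by auto
qed (use T in simp)

lemma has_isk4_of_attached_tripod:
  assumes C: "C = d1 # I1 @ d2 # I2 @ d3 # I3" and cyc: "induced_cycle A C"
    and T: "induced_tripod A z L1 L2 L3" and disj: "set C \<inter> set (z # L1 @ L2 @ L3) = {}"
    and cross: "\<And>x y. x \<in> set C \<Longrightarrow> y \<in> set (z # L1 @ L2 @ L3) \<Longrightarrow>
      (x, y) \<in> A \<longleftrightarrow> x = d1 \<and> y = last (z # L1) \<or> x = d2 \<and> y = last (z # L2)
        \<or> x = d3 \<and> y = last (z # L3)"
  shows "has_isk4 A"
proof (rule has_isk4I)
  let ?T = "z # L1 @ L2 @ L3"
  let ?D = "{(d1, last (z # L1)), (d2, last (z # L2)), (d3, last (z # L3))}"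
  have cycle_arcs: "cycle_arcs C
      = path_arcs (d1 # I1 @ [d2]) \<union> path_arcs (d2 # I2 @ [d3]) \<union> path_arcs (d1 # rev I3 @ [d3])"
    using path_arcs_append_Cons[of "d1 # I1" d2 "I2 @ d3 # I3 @ [d1]"]
      path_arcs_append_Cons[of "d2 # I2" d3 "I3 @ [d1]"] path_arcs_rev[of "d3 # I3 @ [d1]"]
    by (simp add: C cycle_arcs_def Un_assoc)
  have leg: "path_arcs (d # rev L @ [z])
      = path_arcs (z # L) \<union> {(d, last (z # L)), (last (z # L), d)}" for d L
    using path_arcs_append[of "z # L" "[d]"] path_arcs_rev[of "z # L @ [d]"] by auto
  have "Restr A (set C \<union> set ?T) = cycle_arcs C
      \<union> (path_arcs (z # L1) \<union> path_arcs (z # L2) \<union> path_arcs (z # L3)) \<union> (?D \<union> ?D\<inverse>)"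
  proof (subst Restr_Un_eq_iff)
    show "cycle_arcs C \<subseteq> set C \<times> set C"
      by (rule cycle_arcs_subset)
    show "path_arcs (z # L1) \<union> path_arcs (z # L2) \<union> path_arcs (z # L3) \<subseteq> set ?T \<times> set ?T"
      using T by (auto simp: induced_tripod_def)
    show "?D \<subseteq> set C \<times> set ?T" by (auto simp: C)
    show "Restr A (set C) = cycle_arcs C
        \<and> Restr A (set ?T) = path_arcs (z # L1) \<union> path_arcs (z # L2) \<union> path_arcs (z # L3)
        \<and> (\<forall>x\<in>set C. \<forall>y\<in>set ?T. (x, y) \<in> A \<longleftrightarrow> (x, y) \<in> ?D)"
      using cyc T cross by (simp add: induced_cycle_def induced_tripod_def)
  qed (fact disj)
  then show "Restr A (set C \<union> set ?T) = path_arcs (d1 # I1 @ [d2]) \<union> path_arcs (d1 # rev I3 @ [d3])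
      \<union> path_arcs (d1 # rev L1 @ [z]) \<union> path_arcs (d2 # I2 @ [d3]) \<union> path_arcs (d2 # rev L2 @ [z])
      \<union> path_arcs (d3 # rev L3 @ [z])"
    unfolding cycle_arcs leg by auto
  show "distinct ([d1, d2, d3, z] @ I1 @ rev I3 @ rev L1 @ I2 @ rev L2 @ rev L3)"
    using cyc T disj by (auto simp: C induced_cycle_def induced_tripod_def)
qed (auto simp: C)

end

locale triangle_free_graph = simple_graph +
  assumes no_triangle: "(x, y) \<in> A \<Longrightarrow> (y, z) \<in> A \<Longrightarrow> (x, z) \<notin> A"
begin

lemma induced_tripod_of_path_and_vertex:
  assumes R: "induced_path A R" and touches: "y \<in> set R \<or> (\<exists>r\<in>set R. (y, r) \<in> A)"
  obtains z L1 L2 L3 where "induced_tripod A z L1 L2 L3"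
    "set (z # L1 @ L2 @ L3) \<subseteq> insert y (set R)"
    "last (z # L1) = hd R" "last (z # L2) = last R" "last (z # L3) = y"
proof (cases "y \<in> set R")
  case True
  then obtain R1 R2 where "R = R1 @ y # R2" by (meson split_list)
  with R show thesis
    by (intro that[of y "rev R1" R2 "[]"] induced_tripodI) (auto simp: last_rev hd_append)
next
  case False
  with touches have "\<exists>r\<in>set R. (y, r) \<in> A" by blast
  then obtain R1 r R2 where first: "R = R1 @ r # R2" "(y, r) \<in> A" "\<forall>u\<in>set R1. (y, u) \<notin> A"
    by (rule split_list_first_propE) blast
  have hd_R: "last (r # rev R1) = hd R" unfolding first(1) by (cases R1) auto
  show thesis
  proof (cases "\<exists>u\<in>set R2. (y, u) \<in> A")
    case no_more: False
    have "induced_path A [r, y]"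
      using first(2) False adj_sym unfolding first(1) by (auto simp: induced_path_Cons)
    then have "induced_tripod A r (rev R1) R2 [y]"
      using R first no_more False by (intro induced_tripodI) auto
    then show thesis using hd_R first(1) by (intro that[of r "rev R1" R2 "[y]"]) auto
  next
    case True
    then obtain R3 r' R4 where last_nbr: "R2 = R3 @ r' # R4" "(y, r') \<in> A" "\<forall>u\<in>set R4. (y, u) \<notin> A"
      by (rule split_list_last_propE) blast
    have R_eq: "R = (R1 @ [r]) @ R3 @ (r' # R4)" using first(1) last_nbr(1) by simp
    have "(r, r') \<notin> A" using first(2) last_nbr(2) no_triangle adj_sym by blast
    then have R3: "R3 \<noteq> []"
      using R induced_path_append[of "R1 @ [r]" "r' # R4"] unfolding R_eq by auto
    have "induced_path A ((R1 @ [r]) @ y # (r' # R4))"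
    proof (rule induced_path_replace_middle[OF R[unfolded R_eq]])
      show "y \<notin> set (R1 @ [r]) \<union> set (r' # R4)" using False unfolding R_eq by auto
      show "(x, y) \<in> A \<longleftrightarrow> x = last (R1 @ [r]) \<or> x = hd (r' # R4)"
        if "x \<in> set (R1 @ [r]) \<union> set (r' # R4)" for x
        using that first(2,3) last_nbr(2,3) adj_commute[of x y] by auto
    qed (use R3 in simp_all)
    then have "induced_tripod A y (r # rev R1) (r' # R4) []"
      by (intro induced_tripodI) auto
    then show thesis using hd_R R_eq by (intro that[of y "r # rev R1" "r' # R4" "[]"]) auto
  qed
qed

lemma connected_set_obtain_induced_tripod:
  assumes Z: "connected_set A Z" "{p1, p2, p3} \<subseteq> Z"
  obtains z L1 L2 L3 where "induced_tripod A z L1 L2 L3" "set (z # L1 @ L2 @ L3) \<subseteq> Z"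
    "last (z # L1) = p1" "last (z # L2) = p2" "last (z # L3) = p3"
proof -
  obtain R where R: "induced_path A R" "hd R = p1" "last R = p2" "set R \<subseteq> Z"
    using connected_set_obtain_induced_path[OF Z(1), of p1 p2] Z(2) by auto
  obtain M where M: "induced_path A M" "hd M = p3" "last M = p1" "set M \<subseteq> Z"
    using connected_set_obtain_induced_path[OF Z(1), of p3 p1] Z(2) by auto
  let ?touches = "\<lambda>y. y \<in> set R \<or> (\<exists>r\<in>set R. (y, r) \<in> A)"
  have "\<exists>y\<in>set M. ?touches y"
    using M(3) R(2) induced_path_nonempty[OF M(1)] induced_path_nonempty[OF R(1)]
    by (metis hd_in_set last_in_set)
  then obtain M1 y M2 where first: "M = M1 @ y # M2" "?touches y" "\<forall>u\<in>set M1. \<not> ?touches u"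
    by (rule split_list_first_propE) blast
  obtain z L1 L2 L3 where T: "induced_tripod A z L1 L2 L3"
    "set (z # L1 @ L2 @ L3) \<subseteq> insert y (set R)"
    "last (z # L1) = p1" "last (z # L2) = p2" "last (z # L3) = y"
    using induced_tripod_of_path_and_vertex[OF R(1) first(2)] R(2,3) by metis
  have "induced_path A (M1 @ [y])"
    using induced_path_prefix[of "M1 @ [y]" M2] M(1) first(1) by simp
  then have P: "induced_path A (y # rev M1)"
    using induced_path_rev[of A "M1 @ [y]"] by simp
  have "induced_tripod A z L1 L2 (L3 @ rev M1)"
  proof (rule induced_tripod_extend[OF T(1)])
    show "induced_path A (last (z # L3) # rev M1)" using P T(5) by simp
    show "x \<noteq> u \<and> ((x, u) \<in> A \<longrightarrow> u = last (z # L3))"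
      if "x \<in> set (rev M1)" "u \<in> set (z # L1 @ L2 @ L3)" for x u
    proof -
      have "x \<noteq> y" using P that(1) by (auto simp: induced_path_def)
      moreover have "x \<notin> set R" "\<forall>r\<in>set R. (x, r) \<notin> A" using first(3) that(1) by auto
      moreover have "u = y \<or> u \<in> set R" using T(2) that(2) by blast
      ultimately show ?thesis using T(5) by auto
    qed
  qed
  moreover have "set (z # L1 @ L2 @ L3 @ rev M1) \<subseteq> Z"
    using T(2) R(4) M(4) first(1) by auto
  moreover have "last (z # L3 @ rev M1) = p3" using M(2) first(1) T(5) by (cases M1) auto
  ultimately show thesis using that T(3,4) by blast
qed

lemma has_isk4_of_three_attachments:
  assumes cyc: "induced_cycle A C" "{d1, d2, d3} \<subseteq> set C" "d1 \<noteq> d2" "d1 \<noteq> d3" "d2 \<noteq> d3"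
    and Z: "connected_set A Z" "set C \<inter> Z = {}" "{p1, p2, p3} \<subseteq> Z"
    and cross: "\<And>x y. x \<in> set C \<Longrightarrow> y \<in> Z \<Longrightarrow>
      (x, y) \<in> A \<longleftrightarrow> x = d1 \<and> y = p1 \<or> x = d2 \<and> y = p2 \<or> x = d3 \<and> y = p3"
  shows "has_isk4 A"
proof -
  obtain I1 I2 I3 where C: "induced_cycle A (d1 # I1 @ d2 # I2 @ d3 # I3)"
    "set (d1 # I1 @ d2 # I2 @ d3 # I3) = set C"
    using induced_cycle_through_three[OF cyc] by metis
  obtain z L1 L2 L3 where T: "induced_tripod A z L1 L2 L3" "set (z # L1 @ L2 @ L3) \<subseteq> Z"
    "last (z # L1) = p1" "last (z # L2) = p2" "last (z # L3) = p3"
    using connected_set_obtain_induced_tripod[OF Z(1,3)] by metis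
  show ?thesis
    by (rule has_isk4_of_attached_tripod[OF refl C(1) T(1)]; unfold C(2) T(3-5))
      (use Z(2) T(2) cross in blast)+
qed

lemma induced_cycle_split_into_paths:
  assumes cyc: "induced_cycle A C" "{v, s1, s2} \<subseteq> set C" "v \<noteq> s1" "v \<noteq> s2" "s1 \<noteq> s2" "(v, s1) \<notin> A"
  obtains S P where "induced_path A S" "hd S = s1" "last S = s2" "induced_path A P" "last P = v"
    "2 \<le> length S" "set S \<union> set P \<subseteq> set C" "set S \<inter> set P = {}"
    "\<And>x y. x \<in> set S \<Longrightarrow> y \<in> set P \<Longrightarrow> (x, y) \<in> A \<longleftrightarrow> x = s2 \<and> y = hd P"
proof -
  obtain I1 I2 I3 where C: "induced_cycle A (v # I1 @ s1 # I2 @ s2 # I3)"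
    "set (v # I1 @ s1 # I2 @ s2 # I3) = set C"
    using induced_cycle_through_three[OF cyc(1-5)] by metis
  let ?S = "s1 # I2 @ [s2]" and ?P = "I3 @ [v]"
  have "I1 \<noteq> []"
    using C(1) cyc(6) induced_cycle_append[of "[v]" "I1 @ s1 # I2 @ s2 # I3"] by auto
  have rot: "induced_cycle A (?S @ (?P @ I1))"
    using C(1) induced_cycle_rotate[of A "v # I1" "?S @ I3"] by simp
  then have S: "induced_path A ?S" and PI: "induced_path A (?P @ I1)"
    and disj: "set ?S \<inter> set (?P @ I1) = {}"
    using induced_cycle_append[of ?S "?P @ I1"] by blast+
  have P: "induced_path A ?P" using PI by (rule induced_path_prefix) simp
  show thesis
  proof (rule that[OF S _ _ P])
    show "set ?S \<union> set ?P \<subseteq> set C" using C(2) by auto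
    show "set ?S \<inter> set ?P = {}" using disj by auto
    show "(x, y) \<in> A \<longleftrightarrow> x = s2 \<and> y = hd ?P" if "x \<in> set ?S" "y \<in> set ?P" for x y
    proof -
      have "last I1 \<in> set I1" using \<open>I1 \<noteq> []\<close> by simp
      then have "y \<noteq> last (?P @ I1)" using that(2) PI \<open>I1 \<noteq> []\<close> by (auto simp: induced_path_def)
      then show ?thesis using induced_cycle_cross[OF rot, of x y] that by (cases I3) auto
    qed
  qed simp_all
qed

lemma has_isk4_of_path_with_two_hub_neighbours:
  assumes cyc: "induced_cycle A C" "{v, s1, s2} \<subseteq> set C" "v \<noteq> s1" "v \<noteq> s2" "s1 \<noteq> s2" "(v, s1) \<notin> A"
    and Q: "induced_path A Q" "set C \<inter> set Q = {}" "{z1, z2} \<subseteq> set Q" "z1 \<noteq> z2"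
    and cross: "\<And>x y. x \<in> set C - {v} \<Longrightarrow> y \<in> set Q \<Longrightarrow>
      (x, y) \<in> A \<longleftrightarrow> x = s1 \<and> y = hd Q \<or> x = s2 \<and> y = last Q"
    and hub: "\<And>y. y \<in> set Q \<Longrightarrow> (v, y) \<in> A \<longleftrightarrow> y = z1 \<or> y = z2"
  shows "has_isk4 A"
proof -
  obtain S P where S: "induced_path A S" "hd S = s1" "last S = s2" "2 \<le> length S"
    and P: "induced_path A P" "last P = v"
    and SP: "set S \<union> set P \<subseteq> set C" "set S \<inter> set P = {}"
      "\<And>x y. x \<in> set S \<Longrightarrow> y \<in> set P \<Longrightarrow> (x, y) \<in> A \<longleftrightarrow> x = s2 \<and> y = hd P"
    using induced_cycle_split_into_paths[OF cyc] by metis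
  have nonempty: "S \<noteq> []" "P \<noteq> []" "Q \<noteq> []"
    using S(1) P(1) Q(1) by (simp_all add: induced_path_nonempty)
  have ends: "s1 \<in> set S" "s2 \<in> set S" "v \<in> set P" "hd P \<in> set P"
    using S(2,3) P(2) nonempty by auto
  have "3 \<le> length (rev S) + length Q" using S(4) nonempty(3) by (cases Q) auto
  moreover have "set (rev S) \<inter> set Q = {}" using SP(1) Q(2) by auto
  moreover have "(x, y) \<in> A \<longleftrightarrow> x = last (rev S) \<and> y = hd Q \<or> x = hd (rev S) \<and> y = last Q"
    if "x \<in> set (rev S)" "y \<in> set Q" for x y
    using cross[of x y] that S(2,3) SP(1,2) ends(3) by (auto simp: hd_rev last_rev)
  ultimately have "induced_cycle A (rev S @ Q)"
    using S(1) Q(1) nonempty by (subst induced_cycle_append) auto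
  then show ?thesis
  proof (rule has_isk4_of_three_attachments)
    show "connected_set A (set P)" using P(1) by (rule connected_set_induced_path)
    show "{s2, z1, z2} \<subseteq> set (rev S @ Q)" using Q(3) ends by auto
    show "s2 \<noteq> z1" "s2 \<noteq> z2" using SP(1) Q(2,3) ends by auto
    show "set (rev S @ Q) \<inter> set P = {}" using SP(1,2) Q(2) by auto
    show "{hd P, v, v} \<subseteq> set P" using ends by simp
    show "(x, u) \<in> A \<longleftrightarrow> x = s2 \<and> u = hd P \<or> x = z1 \<and> u = v \<or> x = z2 \<and> u = v"
      if x: "x \<in> set (rev S @ Q)" and u: "u \<in> set P" for x u
    proof (cases "x \<in> set S")
      case True
      then have "x \<noteq> z1" "x \<noteq> z2" using SP(1) Q(2,3) by auto
      with SP(3)[OF True u] show ?thesis by simp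
    next
      case False
      then have "x \<in> set Q" "x \<noteq> s2" using x ends by auto
      moreover have "u \<noteq> s1" "u \<noteq> s2" using u SP(2) ends by auto
      ultimately show ?thesis
        using hub[of x] cross[of u x] u SP(1) adj_commute[of x u] by (cases "u = v") auto
    qed
  qed (fact Q(4))
qed

lemma has_isk4_of_hub_and_two_attachments:
  assumes cyc: "induced_cycle A C" "{v, s1, s2} \<subseteq> set C" "v \<noteq> s1" "v \<noteq> s2" "s1 \<noteq> s2" "(v, s1) \<notin> A"
    and Z: "connected_set A Z" "set C \<inter> Z = {}" "{p1, p2, z1, z2} \<subseteq> Z"
    and cross: "\<And>x y. x \<in> set C - {v} \<Longrightarrow> y \<in> Z \<Longrightarrow>
      (x, y) \<in> A \<longleftrightarrow> x = s1 \<and> y = p1 \<or> x = s2 \<and> y = p2"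
    and hub: "\<And>y. y \<in> Z \<Longrightarrow> (v, y) \<in> A \<longleftrightarrow> y = z1 \<or> y = z2"
  shows "has_isk4 A"
  using Z(1,3)
proof (cases rule: connected_set_through_one_or_path_through_both)
  case (one Y z)
  show ?thesis
  proof (rule has_isk4_of_three_attachments[OF cyc(1-5) one(1)])
    show "{z, p1, p2} \<subseteq> Y" "set C \<inter> Y = {}" using one(2-4) Z(2) by auto
    show "(x, y) \<in> A \<longleftrightarrow> x = v \<and> y = z \<or> x = s1 \<and> y = p1 \<or> x = s2 \<and> y = p2"
      if "x \<in> set C" "y \<in> Y" for x y
      using that one(3,4) cross[of x y] hub[of y] cyc(3,4) by (cases "x = v") blast+
  qed
next
  case (both Q)
  show ?thesis
  proof (rule has_isk4_of_path_with_two_hub_neighbours[OF cyc both(1) _ both(5,6)])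
    show "set C \<inter> set Q = {}" using Z(2) both(4) by blast
  qed (use cross hub both(2-4) in auto)
qed

end

section \<open>Induced cycles in a layer\<close>

lemma sublist_between:
  assumes "x \<in> set xs" "y \<in> set xs" "x \<noteq> y"
  obtains B1 B B2 where "xs = B1 @ B @ B2" "2 \<le> length B" "{hd B, last B} = {x, y}"
proof -
  obtain C D where xs: "xs = C @ x # D" using assms(1) by (meson split_list)
  then consider (before) "y \<in> set C" | (after) "y \<in> set D" using assms by auto
  then show thesis
  proof cases
    case before
    then obtain C1 C2 where "C = C1 @ y # C2" by (meson split_list)
    with xs show thesis by (intro that[of C1 "y # C2 @ [x]" D]) auto
  next
    case after
    then obtain D1 D2 where "D = D1 @ y # D2" by (meson split_list)
    with xs show thesis by (intro that[of C "x # D1 @ [y]" D2]) auto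
  qed
qed

text \<open>
  Here \<open>X\<close> is a layer $N_k$, \<open>W\<close> is $N_{k-1}$ and \<open>H\<close> is the union of the earlier layers; \<open>U\<close> is
  a path of steps down to the root, so it meets the layer next to \<open>W\<close> only in \<open>u\<close>.
\<close>

locale layered_graph = triangle_free_graph A for A :: "('a \<times> 'a) set" +
  fixes X W H :: "'a set" and r :: 'a
  assumes disjoint: "X \<inter> W = {}" "X \<inter> H = {}" "W \<inter> H = {}"
    and nonadj_X_H: "x \<in> X \<Longrightarrow> h \<in> H \<Longrightarrow> (x, h) \<notin> A"
    and ex_parent: "x \<in> X \<Longrightarrow> \<exists>w\<in>W. (w, x) \<in> A"
    and ex_descent: "w \<in> W \<Longrightarrow> \<exists>U u. U \<subseteq> H \<and> connected_set A U \<and> {r, u} \<subseteq> U \<and> (w, u) \<in> A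
      \<and> (\<forall>v\<in>W. \<forall>y\<in>U. (v, y) \<in> A \<longrightarrow> y = u)"
    and isk4_free: "\<not> has_isk4 A"
begin

lemma descending_set:
  assumes "w \<in> W"
  obtains U where "connected_set A U" "{w, r} \<subseteq> U" "U \<subseteq> insert w H"
    "\<And>v y z. v \<in> W \<Longrightarrow> {y, z} \<subseteq> U \<Longrightarrow> (v, y) \<in> A \<Longrightarrow> (v, z) \<in> A \<Longrightarrow> y = z"
proof -
  obtain U u where U: "U \<subseteq> H" "connected_set A U" "{r, u} \<subseteq> U" "(w, u) \<in> A"
    "\<forall>v\<in>W. \<forall>y\<in>U. (v, y) \<in> A \<longrightarrow> y = u"
    using ex_descent[OF assms] by blast
  show thesis
  proof (rule that)
    show "connected_set A (insert w U)"
      using connected_set_insert[OF U(2)] U(3,4) adj_sym by blast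
    show "y = z" if "v \<in> W" "{y, z} \<subseteq> insert w U" "(v, y) \<in> A" "(v, z) \<in> A" for v y z
      using that U(4,5) no_triangle[of v w u] by blast
  qed (use U in auto)
qed

lemma connected_set_through:
  assumes "P \<subseteq> W"
  obtains Z where "connected_set A Z" "P \<subseteq> Z" "Z \<subseteq> P \<union> H"
proof -
  have "\<forall>w\<in>P. \<exists>U. connected_set A U \<and> {w, r} \<subseteq> U \<and> U \<subseteq> insert w H"
    using assms descending_set by (metis subsetD)
  then obtain U where U: "\<And>w. w \<in> P \<Longrightarrow> connected_set A (U w) \<and> {w, r} \<subseteq> U w \<and> U w \<subseteq> insert w H"
    by metis
  show thesis
  proof (rule that)
    show "connected_set A (\<Union>(U ` P))" by (rule connected_set_Union) (use U in auto)
  qed (use U in fastforce)+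
qed

lemma linking_set:
  assumes "v \<in> W" "w1 \<in> W" "w2 \<in> W"
  obtains Z z1 z2 where "connected_set A Z" "{w1, w2, z1, z2} \<subseteq> Z" "Z \<subseteq> {w1, w2} \<union> H"
    "\<And>y. y \<in> Z \<Longrightarrow> (v, y) \<in> A \<longleftrightarrow> y = z1 \<or> y = z2"
proof -
  obtain U1 where U1: "connected_set A U1" "{w1, r} \<subseteq> U1" "U1 \<subseteq> insert w1 H"
    "\<And>y z. {y, z} \<subseteq> U1 \<Longrightarrow> (v, y) \<in> A \<Longrightarrow> (v, z) \<in> A \<Longrightarrow> y = z"
    using descending_set[OF assms(2)] assms(1) by metis
  obtain U2 where U2: "connected_set A U2" "{w2, r} \<subseteq> U2" "U2 \<subseteq> insert w2 H"
    "\<And>y z. {y, z} \<subseteq> U2 \<Longrightarrow> (v, y) \<in> A \<Longrightarrow> (v, z) \<in> A \<Longrightarrow> y = z"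
    using descending_set[OF assms(3)] assms(1) by metis
  let ?S = "U1 \<union> U2"
  have S: "connected_set A ?S"
    by (rule connected_set_Un[OF U1(1) U2(1), of r]) (use U1 U2 in auto)
  show thesis
  proof (cases "\<exists>y\<in>?S. (v, y) \<in> A")
    case True
    have "\<exists>z1\<in>?S. \<exists>z2\<in>?S. \<forall>y\<in>?S. (v, y) \<in> A \<longleftrightarrow> y = z1 \<or> y = z2"
    proof (cases "(\<exists>y\<in>U1. (v, y) \<in> A) \<and> (\<exists>y\<in>U2. (v, y) \<in> A)")
      case True
      then obtain z1 z2 where "z1 \<in> U1" "(v, z1) \<in> A" "z2 \<in> U2" "(v, z2) \<in> A" by blast
      then show ?thesis using U1(4) U2(4) by blast
    next
      case False
      obtain z where "z \<in> ?S" "(v, z) \<in> A" using True by blast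
      then show ?thesis using False U1(4) U2(4) by blast
    qed
    then obtain z1 z2 where "{z1, z2} \<subseteq> ?S" "\<forall>y\<in>?S. (v, y) \<in> A \<longleftrightarrow> y = z1 \<or> y = z2"
      by blast
    then show thesis using S U1(2,3) U2(2,3) by (intro that[of ?S z1 z2]) auto
  next
    case False
    obtain U u where U: "U \<subseteq> H" "connected_set A U" "{r, u} \<subseteq> U" "(v, u) \<in> A"
      "\<forall>y\<in>U. (v, y) \<in> A \<longrightarrow> y = u"
      using ex_descent[OF assms(1)] assms(1) by blast
    have "connected_set A (?S \<union> U)"
      by (rule connected_set_Un[OF S U(2), of r]) (use U1 U in auto)
    then show thesis using False U U1(2,3) U2(2,3) by (intro that[of "?S \<union> U" u u]) auto
  qed
qed

lemma no_two_private_parents: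
  assumes cyc: "induced_cycle A C" "v \<in> set C" and hub_in: "v \<in> W" "set C - {v} \<subseteq> X"
    and s12: "{s1, s2} \<subseteq> set C - {v}" "s1 \<noteq> s2" "(v, s1) \<notin> A"
    and parents: "w1 \<in> W - {v}" "w2 \<in> W - {v}"
    and only_child: "\<And>x. x \<in> set C - {v} \<Longrightarrow> (x, w1) \<in> A \<longleftrightarrow> x = s1"
      "\<And>x. x \<in> set C - {v} \<Longrightarrow> (x, w2) \<in> A \<longleftrightarrow> x = s2"
  shows False
proof -
  obtain Z z1 z2 where Z: "connected_set A Z" "{w1, w2, z1, z2} \<subseteq> Z" "Z \<subseteq> {w1, w2} \<union> H"
    and hub_nbrs: "\<And>y. y \<in> Z \<Longrightarrow> (v, y) \<in> A \<longleftrightarrow> y = z1 \<or> y = z2"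
    using linking_set[of v w1 w2] hub_in(1) parents by auto
  have "has_isk4 A"
  proof (rule has_isk4_of_hub_and_two_attachments[OF cyc(1) _ _ _ s12(2,3) Z(1) _ Z(2) _ hub_nbrs])
    show "{v, s1, s2} \<subseteq> set C" "v \<noteq> s1" "v \<noteq> s2" using cyc(2) s12 by auto
    show "set C \<inter> Z = {}" using hub_in parents Z(3) disjoint by blast
    show "(x, y) \<in> A \<longleftrightarrow> x = s1 \<and> y = w1 \<or> x = s2 \<and> y = w2" if "x \<in> set C - {v}" "y \<in> Z" for x y
    proof -
      have "w1 \<noteq> w2" using only_child[of s1] s12 by auto
      moreover have "w1 \<notin> H" "w2 \<notin> H" using parents disjoint by auto
      moreover have "(x, y) \<notin> A" if "y \<in> H" using that \<open>x \<in> _\<close> hub_in(2) nonadj_X_H by blast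
      ultimately show ?thesis using only_child[of x] that Z(3) by blast
    qed
  qed
  with isk4_free show False ..
qed

definition square_path :: "'a \<Rightarrow> 'a \<Rightarrow> 'a \<Rightarrow> 'a \<Rightarrow> 'a \<Rightarrow> bool" where
  "square_path v a1 s a2 y \<longleftrightarrow> induced_path A [a1, s, a2, y] \<and> {a1, s, a2, y} \<subseteq> X
     \<and> v \<in> W \<and> (v, a1) \<in> A \<and> (v, a2) \<in> A"

lemma square_pathD:
  assumes "square_path v a1 s a2 y"
  shows "distinct [v, a1, s, a2, y]" "(a1, s) \<in> A" "(s, a2) \<in> A" "(a2, y) \<in> A"
    "(a1, a2) \<notin> A" "(a1, y) \<notin> A" "(s, y) \<notin> A" "(v, s) \<notin> A" "(v, y) \<notin> A"
    "induced_cycle A [v, a1, s, a2]"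
proof -
  have P: "induced_path A [a1, s, a2, y]" and X: "{a1, s, a2, y} \<subseteq> X"
    and apex: "v \<in> W" "(v, a1) \<in> A" "(v, a2) \<in> A"
    using assms by (auto simp: square_path_def)
  show dist: "distinct [v, a1, s, a2, y]" and adj: "(a1, s) \<in> A" "(s, a2) \<in> A" "(a2, y) \<in> A"
    and "(a1, a2) \<notin> A" "(a1, y) \<notin> A" "(s, y) \<notin> A"
    using P X apex disjoint(1) by (auto simp: induced_path_Cons)
  show nonadj: "(v, s) \<notin> A" "(v, y) \<notin> A"
    using no_triangle[OF apex(2) adj(1)] no_triangle[OF apex(3) adj(3)] by auto
  have "induced_path A [a1, s, a2]"
    using P induced_path_prefix[of "[a1, s, a2]" "[y]"] by simp
  then show "induced_cycle A [v, a1, s, a2]"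
    using apex nonadj dist by (subst induced_cycle_Cons) auto
qed

lemma square_path_adj_iff:
  assumes sq: "square_path v a1 s a2 y" and parent_w: "w \<in> W" "(w, s) \<in> A"
    and parent_q: "q \<in> W" "(q, y) \<in> A" "(q, a1) \<notin> A"
    and qw: "q = w \<or> (w, y) \<notin> A \<and> (q, s) \<notin> A"
    and x: "x \<in> {a1, s, a2}" and u: "u \<in> insert y ({w, q} \<union> H)"
  shows "(x, u) \<in> A \<longleftrightarrow> x = s \<and> u = w \<or> x = a2 \<and> u = y"
proof -
  have X: "{a1, s, a2, y} \<subseteq> X" using sq by (simp add: square_path_def)
  note dist = square_pathD(1)[OF sq] and adj = square_pathD(2-9)[OF sq]
  have nonadj: "(w, a1) \<notin> A" "(w, a2) \<notin> A" "(q, a2) \<notin> A"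
    using no_triangle adj parent_w(2) parent_q(2) adj_sym by blast+
  from u consider (y) "u = y" | (w) "u = w" | (q) "u = q" "q \<noteq> w" | (H) "u \<in> H"
    by blast
  then show ?thesis
  proof cases
    case y
    then show ?thesis using x adj dist X parent_w disjoint by auto
  next
    case w
    then show ?thesis
      using x parent_w adj_sym[OF parent_w(2)] nonadj adj_commute[of x w] dist X disjoint by auto
  next
    case q
    then show ?thesis using x parent_q qw nonadj adj_commute[of x q] dist X disjoint by auto
  next
    case H
    then show ?thesis using x nonadj_X_H[of x u] X parent_w disjoint by auto
  qed
qed

lemma no_parent_beyond_square:
  assumes sq: "square_path v a1 s a2 y" and parent_w: "w \<in> W" "(w, s) \<in> A"
    and parent_q: "q \<in> W" "(q, y) \<in> A" "(q, a1) \<notin> A"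
    and qw: "q = w \<or> (w, y) \<notin> A \<and> (q, s) \<notin> A"
  shows False
proof -
  have X: "{a1, s, a2, y} \<subseteq> X" and apex: "v \<in> W" using sq by (auto simp: square_path_def)
  note dist = square_pathD(1)[OF sq] and adj = square_pathD(2-9)[OF sq]
  obtain Z z1 z2 where Z: "connected_set A Z" "{w, q, z1, z2} \<subseteq> Z" "Z \<subseteq> {w, q} \<union> H"
    and hub: "\<And>u. u \<in> Z \<Longrightarrow> (v, u) \<in> A \<longleftrightarrow> u = z1 \<or> u = z2"
    using linking_set[OF apex parent_w(1) parent_q(1)] by metis
  have y_Z: "y \<notin> Z" using Z(3) X parent_w(1) parent_q(1) disjoint by blast
  have "has_isk4 A"
  proof (rule has_isk4_of_hub_and_two_attachments[OF square_pathD(10)[OF sq]])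
    show "connected_set A (insert y Z)"
      using connected_set_insert[OF Z(1)] Z(2) parent_q(2) by blast
    show "{w, y, z1, z2} \<subseteq> insert y Z" using Z(2) by auto
    have "v \<noteq> w" "v \<noteq> q" using parent_w(2) parent_q(2) adj by auto
    then show "set [v, a1, s, a2] \<inter> insert y Z = {}"
      using Z(3) X apex parent_w(1) parent_q(1) disjoint dist by auto
    show "(v, u) \<in> A \<longleftrightarrow> u = z1 \<or> u = z2" if "u \<in> insert y Z" for u
      using that hub Z(2) y_Z adj by auto
    show "(x, u) \<in> A \<longleftrightarrow> x = s \<and> u = w \<or> x = a2 \<and> u = y"
      if "x \<in> set [v, a1, s, a2] - {v}" "u \<in> insert y Z" for x u
      by (rule square_path_adj_iff[OF sq parent_w parent_q qw]) (use that Z(3) in auto)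
  qed (use dist adj in auto)
  with isk4_free show False ..
qed

lemma square_path_middle_parent:
  assumes sq: "square_path v a1 s a2 y" and parent_w: "w \<in> W" "(w, s) \<in> A"
  shows "(w, y) \<notin> A"
proof
  assume "(w, y) \<in> A"
  moreover have "(w, a1) \<notin> A" using no_triangle parent_w(2) square_pathD(2)[OF sq] adj_sym by blast
  ultimately show False using no_parent_beyond_square[OF sq parent_w parent_w(1)] by blast
qed

lemma square_path_far_parent:
  assumes sq: "square_path v a1 s a2 y" and parent_q: "q \<in> W" "(q, y) \<in> A"
  shows "(q, a1) \<in> A"
proof (rule ccontr)
  assume "(q, a1) \<notin> A"
  obtain w where parent_w: "w \<in> W" "(w, s) \<in> A"
    using ex_parent[of s] sq by (auto simp: square_path_def)
  moreover have "(w, y) \<notin> A" "(q, s) \<notin> A"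
    using square_path_middle_parent[OF sq] parent_w parent_q by blast+
  ultimately show False
    using no_parent_beyond_square[OF sq parent_w parent_q \<open>(q, a1) \<notin> A\<close>] by blast
qed

lemma square_paths_of_long_cycle:
  assumes cyc: "induced_cycle A (a1 # s # a2 # J)" "set (a1 # s # a2 # J) \<subseteq> X" "2 \<le> length J"
    and apex: "v \<in> W" "(v, a1) \<in> A" "(v, a2) \<in> A"
  shows "square_path v a1 s a2 (hd J)" "square_path v a2 s a1 (last J)"
proof -
  have J: "J \<noteq> []" "tl J \<noteq> []" "butlast J \<noteq> []" using cyc(3) by (cases J; auto)+
  have "induced_path A [a1, s, a2, hd J]"
    using induced_cycle_proper_prefix[of "[a1, s, a2, hd J]" "tl J"] cyc(1) J by simp
  then show "square_path v a1 s a2 (hd J)"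
    using apex cyc(2) J(1) by (auto simp: square_path_def)
  have "induced_cycle A ([last J] @ (a1 # s # a2 # butlast J))"
    using cyc(1) J(1) induced_cycle_rotate[of A "[last J]" "a1 # s # a2 # butlast J"] by simp
  then have "induced_path A [last J, a1, s, a2]"
    using induced_cycle_proper_prefix[of "[last J, a1, s, a2]" "butlast J"] J(3) by simp
  then have "induced_path A [a2, s, a1, last J]"
    using induced_path_rev[of A "[last J, a1, s, a2]"] by simp
  then show "square_path v a2 s a1 (last J)"
    using apex cyc(2) J(1) by (auto simp: square_path_def)
qed

lemma no_square_on_long_cycle:
  assumes cyc: "induced_cycle A (a1 # s # a2 # J)" "set (a1 # s # a2 # J) \<subseteq> X" "2 \<le> length J"
    and apex: "v \<in> W" "(v, a1) \<in> A" "(v, a2) \<in> A"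
  shows False
proof -
  define y x where "y = hd J" and "x = last J"
  have sq: "square_path v a1 s a2 y" and sq': "square_path v a2 s a1 x"
    using square_paths_of_long_cycle[OF cyc apex] by (auto simp: y_def x_def)
  have P: "induced_path A [a1, s, a2, y]" and X: "{a1, s, a2, y} \<subseteq> X" "x \<in> X"
    using sq sq' by (auto simp: square_path_def)
  note adj = square_pathD(2-7)[OF sq] and adj' = square_pathD(4)[OF sq']
  obtain w where parent_w: "w \<in> W" "(w, s) \<in> A" using ex_parent[of s] X by blast
  obtain q where parent_q: "q \<in> W" "(q, y) \<in> A" using ex_parent[of y] X by blast
  obtain p where parent_p: "p \<in> W" "(p, x) \<in> A" using ex_parent[of x] X by blast
  have q_a1: "(q, a1) \<in> A" using square_path_far_parent[OF sq parent_q] .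
  have p_a2: "(p, a2) \<in> A" using square_path_far_parent[OF sq' parent_p] .
  have q_nonadj: "(q, s) \<notin> A" "(q, a2) \<notin> A"
    using no_triangle[OF q_a1 adj(1)] no_triangle[of q a2 y] parent_q adj by auto
  have p_nonadj: "(p, a1) \<notin> A" "(p, s) \<notin> A" "(p, y) \<notin> A"
    using no_triangle[of p a1 x] no_triangle[of p s a2] no_triangle[of p a2 y]
      parent_p p_a2 adj adj' by auto
  have w_nonadj: "(w, a1) \<notin> A" "(w, a2) \<notin> A" "(w, y) \<notin> A"
    using no_triangle[of w a1 s] no_triangle[of w s a2] parent_w adj
      square_path_middle_parent[OF sq parent_w] by auto
  have "q \<notin> {a1, s, a2, y}" using parent_q(1) X(1) disjoint(1) by auto
  then have C: "induced_cycle A [q, a1, s, a2, y]"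
    using P parent_q q_a1 q_nonadj by (subst induced_cycle_Cons) auto
  show False
  proof (rule no_two_private_parents[OF C])
    show "(u, w) \<in> A \<longleftrightarrow> u = s" "(u, p) \<in> A \<longleftrightarrow> u = a2" if "u \<in> set [q, a1, s, a2, y] - {q}" for u
      using that parent_w w_nonadj p_a2 p_nonadj adj_commute[of u w] adj_commute[of u p] by auto
    show "{s, a2} \<subseteq> set [q, a1, s, a2, y] - {q}" "s \<noteq> a2"
      using \<open>q \<notin> _\<close> square_pathD(1)[OF sq] by auto
  qed (use X parent_w parent_p parent_q q_a1 q_nonadj p_nonadj w_nonadj in auto)
qed

definition common_parent :: "'a \<Rightarrow> 'a \<Rightarrow> bool" where
  "common_parent u u' \<longleftrightarrow> (\<exists>w\<in>W. (w, u) \<in> A \<and> (w, u') \<in> A)"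

lemma common_parent_commute: "common_parent u u' \<longleftrightarrow> common_parent u' u"
  by (auto simp: common_parent_def)

lemma induced_cycle_common_parent:
  assumes cyc: "induced_cycle A C" "set C \<subseteq> X"
  shows "\<exists>u\<in>set C. \<exists>u'\<in>set C. u \<noteq> u' \<and> common_parent u u'"
proof (rule ccontr)
  assume no: "\<not> ?thesis"
  obtain c1 c2 c3 J where C: "C = c1 # c2 # c3 # J"
    using cyc(1) by (cases C rule: path_arcs.cases) (auto simp: induced_cycle_def Suc_le_length_iff)
  have vertices: "{c1, c2, c3} \<subseteq> set C" "c1 \<noteq> c2" "c1 \<noteq> c3" "c2 \<noteq> c3"
    using cyc(1) by (auto simp: induced_cycle_def C)
  obtain p1 p2 p3 where parents: "p1 \<in> W" "(p1, c1) \<in> A" "p2 \<in> W" "(p2, c2) \<in> A"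
    "p3 \<in> W" "(p3, c3) \<in> A"
    using ex_parent cyc(2) vertices(1) by (metis insert_subset subsetD)
  have only_child: "(x, p) \<in> A \<longleftrightarrow> x = d" if "p \<in> W" "(p, d) \<in> A" "d \<in> set C" "x \<in> set C" for x p d
    using no that adj_commute[of x p] by (auto simp: common_parent_def)
  obtain Z where Z: "connected_set A Z" "{p1, p2, p3} \<subseteq> Z" "Z \<subseteq> {p1, p2, p3} \<union> H"
    using connected_set_through[of "{p1, p2, p3}"] parents by auto
  have "has_isk4 A"
  proof (rule has_isk4_of_three_attachments[OF cyc(1) vertices Z(1) _ Z(2)])
    show "set C \<inter> Z = {}" using Z(3) cyc(2) parents disjoint by blast
    show "(x, y) \<in> A \<longleftrightarrow> x = c1 \<and> y = p1 \<or> x = c2 \<and> y = p2 \<or> x = c3 \<and> y = p3"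
      if x: "x \<in> set C" and y: "y \<in> Z" for x y
    proof -
      have nbrs: "(x, p1) \<in> A \<longleftrightarrow> x = c1" "(x, p2) \<in> A \<longleftrightarrow> x = c2" "(x, p3) \<in> A \<longleftrightarrow> x = c3"
        using only_child[OF _ _ _ x] parents vertices(1) by auto
      show ?thesis
      proof (cases "y \<in> H")
        case True
        then show ?thesis using nonadj_X_H x cyc(2) parents disjoint by blast
      next
        case False
        then have "y = p1 \<or> y = p2 \<or> y = p3" using y Z(3) by blast
        moreover have "p1 \<noteq> p2" "p1 \<noteq> p3" "p2 \<noteq> p3"
          using only_child[of p1 c1 c2] only_child[of p1 c1 c3] only_child[of p2 c2 c3]
            parents vertices adj_sym by auto
        ultimately show ?thesis using nbrs by blast
      qed
    qed
  qed
  with isk4_free show False ..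
qed

definition parent_arc :: "'a list \<Rightarrow> 'a list \<Rightarrow> bool" where
  "parent_arc S J \<longleftrightarrow> induced_cycle A (S @ J) \<and> set (S @ J) \<subseteq> X \<and> 5 \<le> length (S @ J)
     \<and> 2 \<le> length S \<and> common_parent (hd S) (last S)"

lemma parent_arc_between:
  assumes "induced_cycle A (S @ J)" "set (S @ J) \<subseteq> X" "5 \<le> length (S @ J)"
    and "u \<in> set S" "u' \<in> set S" "u \<noteq> u'" "common_parent u u'"
  obtains B1 B B2 where "S = B1 @ B @ B2" "{hd B, last B} = {u, u'}" "parent_arc B (B2 @ J @ B1)"
proof -
  obtain B1 B B2 where B: "S = B1 @ B @ B2" "2 \<le> length B" "{hd B, last B} = {u, u'}"
    using sublist_between[OF assms(4-6)] by metis
  have "induced_cycle A (B @ (B2 @ J @ B1))"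
    using assms(1) induced_cycle_rotate[of A B1 "B @ B2 @ J"] by (simp add: B(1))
  moreover have "common_parent (hd B) (last B)"
    using B(3) assms(7) common_parent_commute by (auto simp: doubleton_eq_iff)
  ultimately show thesis
    using assms(2,3) B by (intro that[of B1 B B2]) (auto simp: parent_arc_def)
qed

lemma shortest_parent_arc:
  assumes "induced_cycle A C" "set C \<subseteq> X" "5 \<le> length C"
  obtains S J where "parent_arc S J"
    "\<And>u u'. u \<in> set S \<Longrightarrow> u' \<in> set S \<Longrightarrow> u \<noteq> u' \<Longrightarrow> common_parent u u' \<Longrightarrow> {u, u'} = {hd S, last S}"
proof -
  obtain u u' where "u \<in> set C" "u' \<in> set C" "u \<noteq> u'" "common_parent u u'"
    using induced_cycle_common_parent[OF assms(1,2)] by blast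
  then have "\<exists>S J. parent_arc S J"
    using parent_arc_between[of C "[]" u u'] assms by (metis append_Nil2)
  then obtain S where ex: "\<exists>J. parent_arc S J"
    and min: "\<And>S'. \<exists>J. parent_arc S' J \<Longrightarrow> length S \<le> length S'"
    using ex_has_least_nat[of "\<lambda>S. \<exists>J. parent_arc S J" _ length] by blast
  obtain J where J: "parent_arc S J" using ex by blast
  have "{u, u'} = {hd S, last S}"
    if u: "u \<in> set S" "u' \<in> set S" "u \<noteq> u'" "common_parent u u'" for u u'
  proof -
    obtain B1 B B2 where B: "S = B1 @ B @ B2" "{hd B, last B} = {u, u'}"
      "parent_arc B (B2 @ J @ B1)"
      using parent_arc_between[OF _ _ _ u] J unfolding parent_arc_def by metis
    have "length S \<le> length B" using min B(3) by blast
    then have "S = B" using B(1) by simp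
    with B(2) show ?thesis by simp
  qed
  with J show thesis using that by blast
qed

lemma no_induced_path_with_private_inner_parents:
  assumes S: "induced_path A S" "set S \<subseteq> X" "S = a1 # s1 # s2 # I @ [a2]"
    and common: "v \<in> W" "(v, a1) \<in> A" "(v, a2) \<in> A"
    and only_pair: "\<And>u u'. u \<in> set S \<Longrightarrow> u' \<in> set S \<Longrightarrow> u \<noteq> u' \<Longrightarrow> common_parent u u' \<Longrightarrow>
      {u, u'} = {a1, a2}"
  shows False
proof -
  have dist: "distinct S" using S(1) by (simp add: induced_path_def)
  have inner: "{s1, s2} \<subseteq> set S - {a1, a2}" "s1 \<noteq> s2" using dist by (auto simp: S(3))
  have nbr: "(x, w) \<in> A \<longleftrightarrow> x = s" if "w \<in> W" "(w, s) \<in> A" "s \<in> {s1, s2}" "x \<in> set S" for x w s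
    using only_pair[of x s] that inner adj_commute[of x w]
    by (auto simp: common_parent_def doubleton_eq_iff)
  have v_nbrs: "(v, y) \<in> A \<longleftrightarrow> y = a1 \<or> y = a2" if "y \<in> set S" for y
    using only_pair[of a1 y] that common S(3) by (auto simp: common_parent_def doubleton_eq_iff)
  have "v \<notin> set S" using common(1) S(2) disjoint(1) by auto
  then have C: "induced_cycle A (v # S)"
    using S(1,3) v_nbrs by (subst induced_cycle_Cons) auto
  obtain w1 w2 where parents: "w1 \<in> W" "(w1, s1) \<in> A" "w2 \<in> W" "(w2, s2) \<in> A"
    using ex_parent[of s1] ex_parent[of s2] S(2,3) by auto
  show False
  proof (rule no_two_private_parents[OF C])
    show "(x, w1) \<in> A \<longleftrightarrow> x = s1" "(x, w2) \<in> A \<longleftrightarrow> x = s2" if "x \<in> set (v # S) - {v}" for x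
      using nbr[OF parents(1,2), of x] nbr[OF parents(3,4), of x] that by auto
    show "w1 \<in> W - {v}" "w2 \<in> W - {v}" using parents v_nbrs inner by auto
    show "(v, s1) \<notin> A" using v_nbrs inner by auto
  qed (use common inner S(2) \<open>v \<notin> set S\<close> in auto)
qed

theorem no_long_induced_cycle:
  assumes "induced_cycle A C" "set C \<subseteq> X" "5 \<le> length C"
  shows False
proof -
  obtain S J where arc: "parent_arc S J"
    and only_pair: "\<And>u u'. u \<in> set S \<Longrightarrow> u' \<in> set S \<Longrightarrow> u \<noteq> u' \<Longrightarrow> common_parent u u' \<Longrightarrow>
      {u, u'} = {hd S, last S}"
    using shortest_parent_arc[OF assms] by metis
  define a1 I a2 where "a1 = hd S" and "I = butlast (tl S)" and "a2 = last S"
  have S: "S = a1 # I @ [a2]"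
    using arc by (cases S) (auto simp: parent_arc_def a1_def I_def a2_def)
  obtain v where common: "v \<in> W" "(v, a1) \<in> A" "(v, a2) \<in> A"
    using arc by (auto simp: parent_arc_def common_parent_def a1_def a2_def)
  have cyc: "induced_cycle A (S @ J)" "set (S @ J) \<subseteq> X" "5 \<le> length (S @ J)"
    using arc by (simp_all add: parent_arc_def)
  have nonadj: "(a1, a2) \<notin> A" using no_triangle common by blast
  have "J \<noteq> []"
  proof
    assume "J = []"
    then have "(a1, a2) \<in> A"
      using cyc(1) induced_cycle_cross[of "a1 # I" "[a2]" a1 a2] by (simp add: S)
    with nonadj show False ..
  qed
  then have path: "induced_path A S"
    using cyc(1) induced_cycle_proper_prefix[of S J] by (simp add: S)
  consider (edge) "I = []" | (square) s where "I = [s]" | (long) s1 s2 I' where "I = s1 # s2 # I'"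
    by (cases I rule: path_arcs.cases) auto
  then show False
  proof cases
    case edge
    then show False using path nonadj by (simp add: S induced_path_Cons)
  next
    case (square s)
    then show False using no_square_on_long_cycle[of a1 s a2 J v] cyc common by (simp add: S)
  next
    case (long s1 s2 I')
    show False
      by (rule no_induced_path_with_private_inner_parents[OF path _ _ common, of s1 s2 I'])
        (use cyc(2) S long only_pair in \<open>auto simp: a1_def[symmetric] a2_def[symmetric]\<close>)
  qed
qed

end

section \<open>Components and odd closed walks\<close>

lemma relpow_sym:
  assumes "sym B" "(x, y) \<in> B ^^ n"
  shows "(y, x) \<in> B ^^ n"
  using assms(2)
proof (induction n arbitrary: y)
  case (Suc n)
  then obtain z where "(x, z) \<in> B ^^ n" "(z, y) \<in> B" by auto
  then show ?case using Suc.IH assms(1) by (meson relpow_Suc_I2 symD)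
qed simp

definition component_root :: "('a \<times> 'a) set \<Rightarrow> 'a \<Rightarrow> 'a" where
  "component_root B x = (SOME y. (x, y) \<in> B\<^sup>*)"

lemma rtrancl_component_root: "(x, component_root B x) \<in> B\<^sup>*"
  unfolding component_root_def by (rule someI[of _ x]) simp

lemma component_root_cong:
  assumes "sym B" "(x, y) \<in> B"
  shows "component_root B x = component_root B y"
proof -
  have "(x, z) \<in> B\<^sup>* \<longleftrightarrow> (y, z) \<in> B\<^sup>*" for z
    using assms by (meson converse_rtrancl_into_rtrancl symD)
  then show ?thesis by (simp add: component_root_def)
qed

lemma two_colouring_of_no_odd_closed_walk:
  assumes "sym B" and odd: "\<And>x n. odd n \<Longrightarrow> (x, x) \<notin> B ^^ n"
  shows "\<exists>c :: 'a \<Rightarrow> bool. \<forall>(x, y)\<in>B. c x \<noteq> c y"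
proof -
  let ?root = "component_root B"
  define c where "c x \<longleftrightarrow> (\<exists>n. even n \<and> (x, ?root x) \<in> B ^^ n)" for x
  have walk: "\<exists>n. (x, ?root x) \<in> B ^^ n \<and> (even n \<longleftrightarrow> c x)" for x
    using rtrancl_component_root[of x B] rtrancl_power[of "(x, ?root x)" B] unfolding c_def by blast
  have "c x \<noteq> c y" if xy: "(x, y) \<in> B" for x y
  proof
    assume eq: "c x = c y"
    have yx: "(y, x) \<in> B" using assms(1) xy by (rule symD)
    have "?root y = ?root x" using component_root_cong[OF assms(1) xy] by simp
    with walk[of x] walk[of y] obtain m n where
      walk_x: "(x, ?root x) \<in> B ^^ m" "even m \<longleftrightarrow> c x"
      and walk_y: "(y, ?root x) \<in> B ^^ n" "even n \<longleftrightarrow> c y"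
      by metis
    have "(x, x) \<in> B ^^ (m + Suc n)"
      using relpow_trans[OF walk_x(1)] relpow_Suc_I[OF relpow_sym[OF assms(1) walk_y(1)] yx]
      by blast
    moreover have "odd (m + Suc n)" using walk_x(2) walk_y(2) eq by auto
    ultimately show False using odd by blast
  qed
  then show ?thesis by blast
qed

context simple_graph
begin

lemma induced_cycle_mapI:
  assumes length_ge_3: "3 \<le> n" and closed: "f n = f 0"
    and step: "\<And>i. i < n \<Longrightarrow> (f i, f (Suc i)) \<in> A"
    and inj: "inj_on f {..<n}"
    and chord: "\<And>i j. i < j \<Longrightarrow> j < n \<Longrightarrow> (f i, f j) \<in> A \<Longrightarrow> j = Suc i \<or> i = 0 \<and> Suc j = n"
  shows "induced_cycle A (map f [0..<n])"
proof -
  let ?C = "map f [0..<n]"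
  have set_C: "set ?C = f ` {..<n}" by auto
  have "?C @ [hd ?C] = map f [0..<Suc n]"
    using length_ge_3 closed by (simp add: hd_map)
  then have arcs: "cycle_arcs ?C = (\<Union>i<n. {(f i, f (Suc i)), (f (Suc i), f i)})"
    by (simp only: cycle_arcs_def path_arcs_map_upt)
  have chord_arcs: "(f i, f j) \<in> cycle_arcs ?C \<and> (f j, f i) \<in> cycle_arcs ?C"
    if "i < j" "j < n" "(f i, f j) \<in> A" for i j
    using chord[OF that]
  proof
    assume "j = Suc i"
    then show ?thesis unfolding arcs using that by auto
  next
    assume "i = 0 \<and> Suc j = n"
    then have "f i = f (Suc j)" using closed by simp
    then show ?thesis unfolding arcs using that by auto
  qed
  have "Restr A (set ?C) = cycle_arcs ?C"
  proof
    show "Restr A (set ?C) \<subseteq> cycle_arcs ?C"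
    proof clarify
      fix x y assume "(x, y) \<in> A" "x \<in> set ?C" "y \<in> set ?C"
      then obtain i j where "i < n" "j < n" "x = f i" "y = f j" "(f i, f j) \<in> A"
        unfolding set_C by auto
      moreover from this have "i \<noteq> j" using adj_irrefl by auto
      ultimately show "(x, y) \<in> cycle_arcs ?C"
        using chord_arcs[of i j] chord_arcs[of j i] adj_sym by (cases "i < j") auto
    qed
    have "cycle_arcs ?C \<subseteq> A" unfolding arcs using step adj_sym by blast
    then show "cycle_arcs ?C \<subseteq> Restr A (set ?C)" using cycle_arcs_subset by blast
  qed
  moreover have "distinct ?C" using inj by (simp add: distinct_map lessThan_atLeast0)
  ultimately show ?thesis using length_ge_3 by (simp add: induced_cycle_def)
qed

lemma shortest_odd_closed_walk_induced_cycle: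
  assumes "odd n" and closed: "f n = f 0" and step: "\<And>i. i < n \<Longrightarrow> (f i, f (Suc i)) \<in> A"
    and shortest: "\<And>m x. odd m \<Longrightarrow> (x, x) \<in> A ^^ m \<Longrightarrow> n \<le> m"
  shows "induced_cycle A (map f [0..<n])"
proof (rule induced_cycle_mapI)
  have segment: "(f i, f j) \<in> A ^^ (j - i)" if "i \<le> j" "j \<le> n" for i j
    unfolding relpow_fun_conv using that step by (intro exI[of _ "\<lambda>k. f (i + k)"]) auto
  have complement: "(f j, f i) \<in> A ^^ (n - j + i)" if "i \<le> j" "j \<le> n" for i j
    using relpow_trans[OF segment[of j n]] segment[of 0 i] closed that by auto
  have "f i \<noteq> f j" if "i < j" "j < n" for i j
  proof
    assume eq: "f i = f j"
    have "odd (j - i) \<or> odd (n - j + i)" using \<open>odd n\<close> that by auto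
    moreover have "(f i, f i) \<in> A ^^ (j - i)" "(f i, f i) \<in> A ^^ (n - j + i)"
      using segment[of i j] complement[of i j] that eq by auto
    ultimately have "n \<le> j - i \<or> n \<le> n - j + i" using shortest by blast
    then show False using that by auto
  qed
  then show "inj_on f {..<n}" by (metis inj_onI lessThan_iff linorder_neqE_nat)
  show "j = Suc i \<or> i = 0 \<and> Suc j = n" if "i < j" "j < n" "(f i, f j) \<in> A" for i j
  proof -
    have "(f i, f i) \<in> A ^^ Suc (j - i)" "(f j, f j) \<in> A ^^ Suc (n - j + i)"
      using relpow_Suc_I[OF segment[of i j]] relpow_Suc_I[OF complement[of i j]] that adj_sym
      by auto
    moreover have "odd (Suc (j - i)) \<or> odd (Suc (n - j + i))" using \<open>odd n\<close> that by auto
    ultimately have "n \<le> Suc (j - i) \<or> n \<le> Suc (n - j + i)" using shortest by blast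
    then show ?thesis using that by auto
  qed
  have "n \<noteq> 1" using step[of 0] closed adj_irrefl by auto
  with \<open>odd n\<close> show "3 \<le> n" by presburger
qed (fact closed step)+

lemma odd_induced_cycle_of_odd_closed_walk:
  assumes "(x, x) \<in> A ^^ m" "odd m"
  shows "\<exists>C. induced_cycle A C \<and> odd (length C)"
proof -
  let ?P = "\<lambda>n. odd n \<and> (\<exists>x. (x, x) \<in> A ^^ n)"
  obtain n where odd_walk: "?P n" and least: "\<And>m. ?P m \<Longrightarrow> n \<le> m"
    using assms exists_least_iff[of ?P] by (metis linorder_not_le)
  then obtain f where walk: "f n = f 0" "\<And>i. i < n \<Longrightarrow> (f i, f (Suc i)) \<in> A"
    unfolding relpow_fun_conv by metis
  have "induced_cycle A (map f [0..<n])"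
    by (rule shortest_odd_closed_walk_induced_cycle) (use odd_walk walk least in blast)+
  with odd_walk show ?thesis by (intro exI[of _ "map f [0..<n]"]) simp
qed

end

lemma (in triangle_free_graph) induced_cycle_length_neq_3:
  assumes "induced_cycle A C"
  shows "length C \<noteq> 3"
proof
  assume "length C = 3"
  then obtain a b c where "C = [a, b, c]"
    by (auto simp: numeral_3_eq_3 length_Suc_conv)
  with assms have "Restr A (set C) = {(a, b), (b, a), (b, c), (c, b), (c, a), (a, c)}"
    by (auto simp: induced_cycle_def cycle_arcs_def)
  then have "(a, b) \<in> A" "(b, c) \<in> A" "(a, c) \<in> A" by blast+
  with no_triangle show False by blast
qed

section \<open>Distance layers and the colouring\<close>

context simple_graph
begin

definition level :: "'a \<Rightarrow> nat" where
  "level x = (LEAST n. (x, component_root A x) \<in> A ^^ n)"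

definition layer :: "'a \<Rightarrow> nat \<Rightarrow> 'a set" where
  "layer \<rho> k = {x. component_root A x = \<rho> \<and> level x = k}"

definition same_level_arcs :: "('a \<times> 'a) set" where
  "same_level_arcs = {(x, y) \<in> A. level x = level y}"

lemma component_root_adj: "(x, y) \<in> A \<Longrightarrow> component_root A x = component_root A y"
  using component_root_cong[of A] adj_sym by (simp add: sym_def)

lemma level_relpow: "(x, component_root A x) \<in> A ^^ level x"
proof -
  obtain n where "(x, component_root A x) \<in> A ^^ n"
    using rtrancl_component_root[of x A] rtrancl_power by blast
  then show ?thesis unfolding level_def by (rule LeastI)
qed

lemma level_le: "(x, component_root A x) \<in> A ^^ n \<Longrightarrow> level x \<le> n"
  unfolding level_def by (rule Least_le)

lemma level_adj: "(x, y) \<in> A \<Longrightarrow> level x \<le> Suc (level y)"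
  using level_relpow[of y] component_root_adj[of x y] by (intro level_le) (metis relpow_Suc_I2)

lemma level_0: "level x = 0 \<Longrightarrow> component_root A x = x"
  using level_relpow[of x] by simp

lemma layer_parent:
  assumes "x \<in> layer \<rho> (Suc k)"
  obtains y where "(x, y) \<in> A" "y \<in> layer \<rho> k"
proof -
  have x_layer: "component_root A x = \<rho>" "level x = Suc k" using assms by (auto simp: layer_def)
  obtain y where y_walk: "(x, y) \<in> A" "(y, \<rho>) \<in> A ^^ k"
    using level_relpow[of x] x_layer by (metis relpow_Suc_D2)
  then have "component_root A y = \<rho>" using component_root_adj x_layer(1) by metis
  moreover have "level y = k"
    using level_le[of y k] level_adj[OF y_walk(1)] y_walk(2) x_layer(2) \<open>component_root A y = \<rho>\<close>
    by simp
  ultimately show thesis using y_walk(1) by (intro that[of y]) (auto simp: layer_def)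
qed

lemma layer_descent:
  assumes "u \<in> layer \<rho> k"
  shows "\<exists>U. connected_set A U \<and> {\<rho>, u} \<subseteq> U \<and> U \<subseteq> (\<Union>j\<le>k. layer \<rho> j) \<and> U \<inter> layer \<rho> k = {u}"
  using assms
proof (induction k arbitrary: u)
  case 0
  then have "u = \<rho>" using level_0[of u] by (auto simp: layer_def)
  with 0 show ?case by (intro exI[of _ "{u}"]) (auto simp: connected_set_singleton)
next
  case (Suc k)
  obtain y where parent: "(u, y) \<in> A" "y \<in> layer \<rho> k" using layer_parent[OF Suc.prems] .
  obtain U where U: "connected_set A U" "{\<rho>, y} \<subseteq> U" "U \<subseteq> (\<Union>j\<le>k. layer \<rho> j)"
    using Suc.IH[OF parent(2)] by blast
  have "connected_set A (insert u U)"
    using connected_set_insert[OF U(1), of y u] U(2) parent(1) adj_sym by blast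
  moreover have "U \<inter> layer \<rho> (Suc k) = {}" using U(3) by (auto simp: layer_def)
  moreover have "insert u U \<subseteq> (\<Union>j\<le>Suc k. layer \<rho> j)" using U(3) Suc.prems by (auto simp: atMost_Suc)
  ultimately show ?case using U(2) Suc.prems by (intro exI[of _ "insert u U"]) auto
qed

lemma simple_graph_same_level_arcs: "simple_graph same_level_arcs"
  by unfold_locales (auto simp: same_level_arcs_def adj_irrefl adj_sym)

lemma induced_cycle_same_level_arcs:
  assumes "induced_cycle same_level_arcs C"
  shows "induced_cycle A C \<and> (\<exists>\<rho> k. set C \<subseteq> layer \<rho> k)"
proof -
  have arcs: "cycle_arcs C \<subseteq> same_level_arcs" using assms by (auto simp: induced_cycle_def)
  have same: "component_root A x = component_root A y \<and> level x = level y"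
    if "x \<in> set C" "y \<in> set C" for x y
  proof -
    have "(x, y) \<in> (cycle_arcs C)\<^sup>*"
      using that path_arcs_connected[of x "C @ [hd C]" y] by (simp add: cycle_arcs_def)
    then show ?thesis
      by (induction rule: rtrancl_induct)
        (use arcs in \<open>auto simp: same_level_arcs_def dest!: component_root_adj\<close>)
  qed
  then have "Restr same_level_arcs (set C) = Restr A (set C)"
    by (auto simp: same_level_arcs_def)
  then have "induced_cycle A C" using assms by (simp add: induced_cycle_def)
  moreover have "set C \<subseteq> layer (component_root A (hd C)) (level (hd C))"
    using same hd_in_set[of C] by (cases C) (auto simp: layer_def)
  ultimately show ?thesis by blast
qed

end

context triangle_free_graph
begin

lemma layered_graph_layers:
  assumes "\<not> has_isk4 A"
  shows "layered_graph A (layer \<rho> (Suc (Suc k))) (layer \<rho> (Suc k)) (\<Union>j\<le>k. layer \<rho> j) \<rho>"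
    (is "layered_graph A ?X ?W ?H \<rho>")
proof
  show "(x, h) \<notin> A" if "x \<in> ?X" "h \<in> ?H" for x h
    using level_adj[of x h] that by (auto simp: layer_def)
  show "\<exists>w\<in>?W. (w, x) \<in> A" if "x \<in> ?X" for x
    using layer_parent[OF that] adj_sym by blast
  show "\<exists>U u. U \<subseteq> ?H \<and> connected_set A U \<and> {\<rho>, u} \<subseteq> U \<and> (w, u) \<in> A
      \<and> (\<forall>v\<in>?W. \<forall>y\<in>U. (v, y) \<in> A \<longrightarrow> y = u)" if w: "w \<in> ?W" for w
  proof -
    obtain u where parent: "(w, u) \<in> A" "u \<in> layer \<rho> k" using layer_parent[OF w] .
    obtain U where U: "connected_set A U" "{\<rho>, u} \<subseteq> U" "U \<subseteq> ?H" "U \<inter> layer \<rho> k = {u}"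
      using layer_descent[OF parent(2)] by blast
    have "y = u" if "v \<in> ?W" "y \<in> U" "(v, y) \<in> A" for v y
    proof -
      have "y \<in> layer \<rho> k" using that U(3) level_adj[OF that(3)] by (auto simp: layer_def)
      with that(2) U(4) show ?thesis by blast
    qed
    then show ?thesis using U(1-3) parent(1) by blast
  qed
  show "?X \<inter> ?W = {}" "?X \<inter> ?H = {}" "?W \<inter> ?H = {}"
    by (auto simp: layer_def)
qed (fact assms)

lemma level_ge_2_of_same_level_adj:
  assumes "(x, y) \<in> A" "level x = level y"
  shows "2 \<le> level x"
proof -
  have root: "component_root A x = component_root A y" using assms(1) by (rule component_root_adj)
  have "level x \<noteq> 0" using level_0[of x] level_0[of y] root assms adj_irrefl[of x] by metis
  moreover have "level x \<noteq> 1"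
  proof
    assume "level x = 1"
    then have "(x, component_root A x) \<in> A" "(y, component_root A x) \<in> A"
      using level_relpow[of x] level_relpow[of y] assms(2) root by auto
    with assms(1) no_triangle show False by blast
  qed
  ultimately show ?thesis by simp
qed

lemma no_odd_closed_walk_same_level_arcs:
  assumes "\<not> has_isk4 A" "odd n"
  shows "(x, x) \<notin> same_level_arcs ^^ n"
proof
  assume "(x, x) \<in> same_level_arcs ^^ n"
  then obtain C where "induced_cycle same_level_arcs C" and odd: "odd (length C)"
    using simple_graph.odd_induced_cycle_of_odd_closed_walk[OF simple_graph_same_level_arcs]
      assms(2) by blast
  then obtain \<rho> k where C: "induced_cycle A C" "set C \<subseteq> layer \<rho> k"
    using induced_cycle_same_level_arcs by blast
  have "3 \<le> length C" using C(1) by (simp add: induced_cycle_def)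
  moreover have "length C \<noteq> 3" using C(1) by (rule induced_cycle_length_neq_3)
  ultimately have long: "5 \<le> length C" using odd by presburger
  then obtain a b C' where "C = a # b # C'" by (cases C rule: path_arcs.cases) simp_all
  then have "(a, b) \<in> Restr A (set C)" using C(1) by (auto simp: induced_cycle_def cycle_arcs_def)
  then have "2 \<le> k"
    using C(2) level_ge_2_of_same_level_adj[of a b] by (auto simp: layer_def)
  then obtain i where k: "k = Suc (Suc i)" by (auto dest: le_Suc_ex)
  interpret layered_graph A "layer \<rho> (Suc (Suc i))" "layer \<rho> (Suc i)" "\<Union>j\<le>i. layer \<rho> j" \<rho>
    using assms(1) by (rule layered_graph_layers)
  show False using no_long_induced_cycle[OF C(1) C(2)[unfolded k] long] .
qed

theorem four_colouring:
  assumes "\<not> has_isk4 A"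
  shows "\<exists>c :: 'a \<Rightarrow> nat. (\<forall>x. c x < 4) \<and> (\<forall>(x, y)\<in>A. c x \<noteq> c y)"
proof -
  obtain d :: "'a \<Rightarrow> bool" where colours_differ: "\<forall>(x, y)\<in>same_level_arcs. d x \<noteq> d y"
    using two_colouring_of_no_odd_closed_walk[OF _ no_odd_closed_walk_same_level_arcs[OF assms]]
    by (auto simp: sym_def same_level_arcs_def adj_sym)
  define c :: "'a \<Rightarrow> nat" where "c x = 2 * (level x mod 2) + of_bool (d x)" for x
  have "c x \<noteq> c y" if xy: "(x, y) \<in> A" for x y
  proof (cases "level x = level y")
    case True
    then have "d x \<noteq> d y" using colours_differ xy by (auto simp: same_level_arcs_def)
    with True show ?thesis by (auto simp: c_def)
  next
    case False
    then have "even (level x) \<longleftrightarrow> odd (level y)"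
      using level_adj[OF xy] level_adj[OF adj_sym[OF xy]] by presburger
    then have "c x div 2 \<noteq> c y div 2" by (auto simp: c_def)
    then show ?thesis by auto
  qed
  moreover have "c x < 4" for x unfolding c_def by (auto simp: mod2_eq_if)
  ultimately show ?thesis by blast
qed

end

context pair_graph
begin

lemma induced_subgraph_with_projI:
  assumes "pverts H \<subseteq> pverts G" "parcs H = Restr (parcs G) (pverts H)"
  shows "induced_subgraph (with_proj H) (with_proj G)"
proof (rule induced_subgraphI)
  show "subgraph (with_proj H) (with_proj G)"
    using assms wf_digraph by (auto simp: subgraph_def compatible_def wf_digraph_def)
  show "arcs (with_proj H) = {e \<in> arcs (with_proj G). tail (with_proj G) e \<in> verts (with_proj H)
      \<and> head (with_proj G) e \<in> verts (with_proj H)}"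
    using assms by auto
qed

lemma simple_graph_parcs: "simple_graph (parcs G)"
proof
  show "(y, x) \<in> parcs G" if "(x, y) \<in> parcs G" for x y
    using that arcs_symmetric by blast
  show "(x, x) \<notin> parcs G" for x
    using no_loops' by blast
qed

lemma triangle_free_graph_parcs:
  assumes "\<not> (\<exists>H :: 'a pair_pre_digraph.
    induced_subgraph (with_proj H) (with_proj G) \<and> K\<^bsub>3\<^esub> (with_proj H))"
  shows "triangle_free_graph (parcs G)"
proof -
  interpret simple_graph "parcs G" by (rule simple_graph_parcs)
  show ?thesis
  proof
    fix x y z
    assume xy: "(x, y) \<in> parcs G" and yz: "(y, z) \<in> parcs G"
    show "(x, z) \<notin> parcs G"
    proof
      assume xz: "(x, z) \<in> parcs G"
      define H where "H = \<lparr>pverts = {x, y, z}, parcs = Restr (parcs G) {x, y, z}\<rparr>"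
      have "induced_subgraph (with_proj H) (with_proj G)"
        by (rule induced_subgraph_with_projI)
          (use xy yz in \<open>auto simp: H_def dest: in_arcsD1 in_arcsD2\<close>)
      moreover have "x \<noteq> y" "y \<noteq> z" "x \<noteq> z" using xy yz xz adj_irrefl by blast+
      then have "K\<^bsub>3\<^esub> (with_proj H)"
        unfolding complete_digraph_pair_def H_def using xy yz xz adj_sym adj_irrefl by auto
      ultimately show False using assms by blast
    qed
  qed
qed

lemma not_has_isk4_parcs:
  assumes "\<not> (\<exists>(K :: 'a pair_pre_digraph) (H :: 'a pair_pre_digraph).
    induced_subgraph (with_proj H) (with_proj G) \<and> K\<^bsub>4\<^esub> (with_proj K) \<and> subdivision_pair K H)"
  shows "\<not> has_isk4 (parcs G)"
proof -
  have "Field (parcs G) \<subseteq> pverts G"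
    by (auto simp: Field_def dest: in_arcsD1 in_arcsD2)
  then show ?thesis
    using assms induced_subgraph_with_projI unfolding has_isk4_def by (meson subset_trans)
qed

end

theorem theorem1p7:
  fixes G :: "'a pair_pre_digraph"
  assumes "pair_graph G"
    and "\<not> (\<exists>H :: 'a pair_pre_digraph.
              induced_subgraph (with_proj H) (with_proj G) \<and> K\<^bsub>3\<^esub> (with_proj H))"
    and "\<not> (\<exists>(K :: 'a pair_pre_digraph) (H :: 'a pair_pre_digraph).
              induced_subgraph (with_proj H) (with_proj G)
              \<and> K\<^bsub>4\<^esub> (with_proj K) \<and> subdivision_pair K H)"
  shows "chromatic_number G \<le> 4"
proof -
  interpret pair_graph G by fact
  interpret triangle_free_graph "parcs G"
    using assms(2) by (rule triangle_free_graph_parcs)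
  have "\<not> has_isk4 (parcs G)"
    using assms(3) by (rule not_has_isk4_parcs)
  then obtain c :: "'a \<Rightarrow> nat" where "\<forall>x. c x < 4" "\<forall>(x, y)\<in>parcs G. c x \<noteq> c y"
    using four_colouring by blast
  then have "proper_colouring G 4 c" by (auto simp: proper_colouring_def)
  then show ?thesis using chromatic_number_le_iff by blast
qed

end
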